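(* Let $h\in\operatorname{BiLip}(\mathbb T)$, and let $H:\mathbb R\to\mathbb R$ be a lift of $h$. Then $E_h$ is quasiconformal if $h$ preserves orientation and antiquasiconformal if $h$ reverses orientation. Moreover, $$K(E_h)=\operatorname*{ess\,sup}_{\theta\in[0,2\pi]}\max\left\{|H'(\theta)|,\frac1{|H'(\theta)|}\right\}.$$
   Context: $\mathbb D=\{z\in\mathbb C:|z|<1\}$, $\mathbb T=\partial\mathbb D$. $\operatorname{BiLip}(\mathbb T)$ is the group of circle homeomorphisms $h$ (of either orientation) for which there is $L\ge1$ with $L^{-1}d_{\mathbb T}(\zeta,\eta)\le d_{\mathbb T}(h(\zeta),h(\eta))\le L\,d_{\mathbb T}(\zeta,\eta)$ for all $\zeta,\eta\in\mathbb T$, where $d_{\mathbb T}$ is the normalized arclength distance along the shorter arc. A lift of $h$ is a continuous $H:\mathbb R\to\mathbb R$ with $h(e^{i\theta})=e^{iH(\theta)}$ (so $H(\theta+2\pi)=H(\theta)+2\pi$ if $h$ preserves orientation and $H(\theta+2\pi)=H(\theta)-2\pi$ if $h$ reverses orientation). The radial extension $E_h:\mathbb D\to\mathbb D$ is $E_h(0)=0$, $E_h(r\zeta)=rh(\zeta)$ for $0<r<1$, $\zeta\in\mathbb T$. Quasiconformal maps are orientation-preserving homeomorphisms of $\mathbb D$ that are $K$-quasiconformal for some finite $K\ge1$; for quasiconformal $F$, $K(F)$ denotes the maximal dilatation (the smallest such $K$). With $J(z)=\overline z$, a homeomorphism $F$ of $\mathbb D$ is antiquasiconformal if $F\circ J$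 is quasiconformal, and then $K(F)=K(F\circ J)$. *)

theory Defs
  imports "HOL-Complex_Analysis.Complex_Analysis" "HOL-Probability.Essential_Supremum"
begin

section \<open>Bi-Lipschitz circle homeomorphisms\<close>

abbreviation unit_disc :: "complex set" where "unit_disc \<equiv> ball 0 1"
abbreviation unit_circle :: "complex set" where "unit_circle \<equiv> sphere 0 1"

text \<open>Since \<^const>\<open>Arg\<close> takes values in \<open>(-pi, pi]\<close>, \<open>\<bar>Arg (\<eta> / \<zeta>)\<bar>\<close> is the length of the
  shorter arc; it is normalized so that the whole circle has length 1.\<close>

definition circle_dist :: "complex \<Rightarrow> complex \<Rightarrow> real" where
  "circle_dist \<zeta> \<eta> = \<bar>Arg (\<eta> / \<zeta>)\<bar> / (2 * pi)"

text \<open>Circle and disc maps are total functions on \<^typ>\<open>complex\<close>; only their values on the circle,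
  respectively the disc, matter.\<close>

definition self_homeomorphism :: "complex set \<Rightarrow> (complex \<Rightarrow> complex) \<Rightarrow> bool" where
  "self_homeomorphism S f \<longleftrightarrow> (\<exists>g. homeomorphism S S f g)"

definition BiLip_circle :: "(complex \<Rightarrow> complex) set" where
  "BiLip_circle = {h. self_homeomorphism unit_circle h \<and>
     (\<exists>L\<ge>1. \<forall>\<zeta>\<in>unit_circle. \<forall>\<eta>\<in>unit_circle.
        circle_dist \<zeta> \<eta> / L \<le> circle_dist (h \<zeta>) (h \<eta>) \<and>
        circle_dist (h \<zeta>) (h \<eta>) \<le> L * circle_dist \<zeta> \<eta>)}"

text \<open>Orientation of a circle homeomorphism is read off from its degree.\<close>

definition circle_orientation_preserving :: "(complex \<Rightarrow> complex) \<Rightarrow> bool" where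
  "circle_orientation_preserving h \<longleftrightarrow> winding_number (h \<circ> circlepath 0 1) 0 = 1"

definition circle_orientation_reversing :: "(complex \<Rightarrow> complex) \<Rightarrow> bool" where
  "circle_orientation_reversing h \<longleftrightarrow> winding_number (h \<circ> circlepath 0 1) 0 = -1"

definition is_lift :: "(complex \<Rightarrow> complex) \<Rightarrow> (real \<Rightarrow> real) \<Rightarrow> bool" where
  "is_lift h H \<longleftrightarrow> continuous_on UNIV H \<and> (\<forall>\<theta>. h (cis \<theta>) = cis (H \<theta>))"

definition radial_extension :: "(complex \<Rightarrow> complex) \<Rightarrow> complex \<Rightarrow> complex" where
  "radial_extension h z = (if z = 0 then 0 else of_real (norm z) * h (z / of_real (norm z)))"


section \<open>Quasiconformal maps of the disc\<close>

text \<open>A homeomorphism of the disc preserves orientation iff its local degree is 1 at every point.\<close>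

definition disc_orientation_preserving :: "(complex \<Rightarrow> complex) \<Rightarrow> bool" where
  "disc_orientation_preserving F \<longleftrightarrow>
     (\<forall>z r. 0 < r \<and> cball z r \<subseteq> unit_disc \<longrightarrow> winding_number (F \<circ> circlepath z r) (F z) = 1)"

text \<open>The usual \<open>\<epsilon>\<close>-\<open>\<delta>\<close> definition of absolute continuity on a set of reals; \<open>\<D>\<close> ranges over
  finite families of non-overlapping compact intervals \<open>[Inf k, Sup k]\<close> contained in \<open>S\<close>.\<close>

definition abs_continuous_on :: "real set \<Rightarrow> (real \<Rightarrow> complex) \<Rightarrow> bool" where
  "abs_continuous_on S f \<longleftrightarrow>
     (\<forall>\<epsilon>>0. \<exists>\<delta>>0. \<forall>\<D>. \<D> division_of \<Union>\<D> \<and> \<Union>\<D> \<subseteq> S \<and> (\<Sum>k\<in>\<D>. Sup k - Inf k) < \<delta> \<longrightarrow>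
        (\<Sum>k\<in>\<D>. norm (f (Sup k) - f (Inf k))) < \<epsilon>)"

text \<open>Absolute continuity on lines: on every closed rectangle in the disc with sides parallel to
  the axes, \<open>F\<close> is absolutely continuous on almost every horizontal and almost every vertical
  segment.\<close>

definition ACL_disc :: "(complex \<Rightarrow> complex) \<Rightarrow> bool" where
  "ACL_disc F \<longleftrightarrow>
     (\<forall>a b. cbox a b \<subseteq> unit_disc \<longrightarrow>
        (AE y in lebesgue. y \<in> {Im a..Im b} \<longrightarrow>
           abs_continuous_on {Re a..Re b} (\<lambda>x. F (Complex x y))) \<and>
        (AE x in lebesgue. x \<in> {Re a..Re b} \<longrightarrow>
           abs_continuous_on {Im a..Im b} (\<lambda>y. F (Complex x y))))"

definition has_partials_at :: "(complex \<Rightarrow> complex) \<Rightarrow> complex \<Rightarrow> bool" where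
  "has_partials_at F z \<longleftrightarrow>
     (\<lambda>t::real. F (z + of_real t)) differentiable (at 0) \<and>
     (\<lambda>t::real. F (z + \<i> * of_real t)) differentiable (at 0)"

definition partial_x :: "(complex \<Rightarrow> complex) \<Rightarrow> complex \<Rightarrow> complex" where
  "partial_x F z = vector_derivative (\<lambda>t::real. F (z + of_real t)) (at 0)"

definition partial_y :: "(complex \<Rightarrow> complex) \<Rightarrow> complex \<Rightarrow> complex" where
  "partial_y F z = vector_derivative (\<lambda>t::real. F (z + \<i> * of_real t)) (at 0)"

definition wirtinger_z :: "(complex \<Rightarrow> complex) \<Rightarrow> complex \<Rightarrow> complex" where
  "wirtinger_z F z = (partial_x F z - \<i> * partial_y F z) / 2"

definition wirtinger_zbar :: "(complex \<Rightarrow> complex) \<Rightarrow> complex \<Rightarrow> complex" where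
  "wirtinger_zbar F z = (partial_x F z + \<i> * partial_y F z) / 2"

text \<open>The analytic definition (Ahlfors, Lectures on Quasiconformal Mappings, Chapter II). The
  partial derivatives of an ACL map exist almost everywhere; this is stated explicitly so that
  the dilatation inequality never refers to an unspecified value.\<close>

definition K_quasiconformal :: "real \<Rightarrow> (complex \<Rightarrow> complex) \<Rightarrow> bool" where
  "K_quasiconformal K F \<longleftrightarrow>
     1 \<le> K \<and> self_homeomorphism unit_disc F \<and> disc_orientation_preserving F \<and> ACL_disc F \<and>
     (AE z in lebesgue. z \<in> unit_disc \<longrightarrow>
        has_partials_at F z \<and>
        norm (wirtinger_zbar F z) \<le> (K - 1) / (K + 1) * norm (wirtinger_z F z))"

definition quasiconformal :: "(complex \<Rightarrow> complex) \<Rightarrow> bool" where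
  "quasiconformal F \<longleftrightarrow> (\<exists>K. K_quasiconformal K F)"

definition antiquasiconformal :: "(complex \<Rightarrow> complex) \<Rightarrow> bool" where
  "antiquasiconformal F \<longleftrightarrow> self_homeomorphism unit_disc F \<and> quasiconformal (F \<circ> cnj)"

text \<open>For a (anti)quasiconformal map the infimum is attained, since the dilatation inequality is
  preserved under limits of \<open>K\<close>; hence it is the smallest admissible \<open>K\<close>. On other maps the
  value is irrelevant.\<close>

definition max_dilatation :: "(complex \<Rightarrow> complex) \<Rightarrow> real" where
  "max_dilatation F =
     (if quasiconformal F then Inf {K. K_quasiconformal K F}
      else Inf {K. K_quasiconformal K (F \<circ> cnj)})"

end

theory Submission
  imports Defs
begin

text \<open>
  In logarithmic coordinates \<open>z = exp (s + i t)\<close> the radial extension becomes \<open>s + i t \<mapsto> s + i H t\<close>.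
  At every point where the lift \<open>H\<close> is differentiable its differential is \<open>diag (1, H' t)\<close>, and
  since \<open>exp\<close> is conformal, the dilatation of the extension at \<open>z\<close> is that of this diagonal matrix: for
  \<open>H' > 0\<close> the moduli of the Wirtinger derivatives are \<open>(1 + H') / 2\<close> and \<open>\<bar>1 - H'\<bar> / 2\<close>, and their ratio is at
  most \<open>(K - 1) / (K + 1)\<close> exactly if \<open>max H' (1 / H') \<le> K\<close> (\<open>log_chart_wirtinger\<close>,
  \<open>dilatation_inequality_iff\<close>).

  The lift is Lipschitz (\<open>lift_lipschitz\<close>), hence differentiable almost everywhere by the
  one-dimensional Rademacher theorem \<open>lipschitz_AE_differentiable\<close>, and \<open>\<bar>H'\<bar>\<close> lies
  between two positive constants (\<open>lift_deriv_bounds\<close>). Because \<open>exp\<close> and its local inverses preserve null sets, a property holds at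
  almost every point of the disc exactly if it holds at almost every angle, as long as it depends on
  the angle only (\<open>AE_disc_from_angles\<close>, \<open>AE_angles_from_disc\<close>).

  The topological and absolute continuity requirements on a quasiconformal map do not involve \<open>K\<close>.
  The extension is Lipschitz on the whole plane (\<open>radial_extension_lipschitz\<close>) and therefore absolutely continuous on every line;
  it is a homeomorphism with inverse the extension of the inverse circle map; and its local degree is that of
  \<open>h\<close>, by deforming an arbitrary circle to the unit circle (\<open>winding_number_radial_extension\<close>).
  So for orientation-preserving \<open>h\<close> the admissible \<open>K\<close> are the essential upper bounds of
  \<open>max \<bar>H'\<bar> (1 / \<bar>H'\<bar>)\<close>, and their infimum is the essential supremum. An orientation-reversing \<open>h\<close> is
  precomposed with complex conjugation, which replaces \<open>H t\<close> by \<open>H (2 pi - t)\<close>.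
\<close>

section \<open>Lipschitz functions of a real variable\<close>

text \<open>An expanding Lipschitz function \<open>F\<close> is a homeomorphism of the line with Lipschitz inverse, and
  \<open>A \<mapsto> \<bar>F ` A\<bar>\<close> is a measure that vanishes on null sets because \<open>F\<close> is Lipschitz. Its
  Radon-Nikodym density \<open>g\<close> satisfies \<open>F b - F a = \<integral> g\<close> over \<open>[a, b]\<close>, so the Lebesgue
  differentiation theorem identifies \<open>g\<close> with \<open>F'\<close> almost everywhere.\<close>

lemma expanding_lipschitz_AE_differentiable:
  fixes F :: "real \<Rightarrow> real"
  assumes lip: "M-lipschitz_on UNIV F"
    and expand: "\<And>x y. x \<le> y \<Longrightarrow> y - x \<le> F y - F x"
  obtains g where "g \<in> borel_measurable borel"
    "AE x in lebesgue. (F has_real_derivative g x) (at x)"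
proof -
  have contF: "continuous_on UNIV F"
    using lip lipschitz_on_continuous_on by blast
  have mono: "F x < F y \<longleftrightarrow> x < y" for x y
    using expand[of x y] expand[of y x] by linarith
  have monole: "F x \<le> F y \<longleftrightarrow> x \<le> y" for x y
    using mono[of y x] by linarith
  have inj: "inj F"
    using mono by (metis injI less_irrefl linorder_neqE_linordered_idom)
  have surj: "\<exists>x. F x = y" for y
  proof -
    define c where "c = \<bar>y - F 0\<bar>"
    have "F (- c) \<le> y" "y \<le> F c"
      using expand[of "-c" 0] expand[of 0 c] unfolding c_def by auto
    moreover have "continuous_on {-c..c} F" "- c \<le> c"
      using contF continuous_on_subset by (auto simp: c_def)
    ultimately show ?thesis
      using IVT'[of F "-c" y c] by auto
  qed
  define G where "G = inv F"
  have FG [simp]: "F (G y) = y" for y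
    unfolding G_def by (rule f_inv_into_f) (use surj in \<open>metis rangeI\<close>)
  have GF [simp]: "G (F x) = x" for x
    unfolding G_def using inj by simp
  have "1-lipschitz_on UNIV G"
  proof (rule lipschitz_onI)
    fix x y show "dist (G x) (G y) \<le> 1 * dist x y"
      using expand[of "G x" "G y"] expand[of "G y" "G x"] by (simp add: dist_real_def) linarith
  qed auto
  then have Gm [measurable]: "G \<in> borel_measurable borel"
    by (intro borel_measurable_continuous_onI) (rule lipschitz_on_continuous_on)
  have vimG: "G -` A = F ` A" for A
    by (auto simp: image_iff) (metis FG)
  \<comment> \<open>the push-forward of Lebesgue measure under \<open>G\<close> is the measure \<open>A \<mapsto> \<bar>F ` A\<bar>\<close>\<close>
  define N where "N = distr lborel borel G"
  have emN: "emeasure N A = emeasure lborel (F ` A)" if "A \<in> sets borel" for A :: "real set"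
    using that by (simp add: N_def emeasure_distr vimG)
  have "absolutely_continuous lborel N"
    unfolding absolutely_continuous_def
  proof
    fix A :: "real set" assume A: "A \<in> null_sets lborel"
    then have Ab: "A \<in> sets borel" by auto
    have "negligible A"
      using A by (simp add: negligible_iff_null_sets null_sets_completionI)
    then have "negligible (F ` A)"
    proof (rule negligible_locally_Lipschitz_image[rotated])
      fix x assume "x \<in> A"
      show "\<exists>T B. open T \<and> x \<in> T \<and> (\<forall>y\<in>A \<inter> T. norm (F y - F x) \<le> B * norm (y - x))"
        using lipschitz_on_normD[OF lip] by (intro exI[of _ UNIV] exI[of _ M]) auto
    qed simp
    then have "F ` A \<in> null_sets lebesgue" by (simp add: negligible_iff_null_sets)
    moreover have "F ` A \<in> sets borel"
      using measurable_sets[OF Gm Ab] by (simp add: vimG)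
    ultimately have "emeasure lborel (F ` A) = 0"
      by (simp add: null_sets_completion_iff null_setsD1)
    then show "A \<in> null_sets N"
      using Ab emN by (simp add: N_def null_sets_def)
  qed
  then obtain g0 where g0 [measurable]: "g0 \<in> borel_measurable lborel" and dens: "density lborel g0 = N"
    using sigma_finite_measure.Radon_Nikodym[OF sigma_finite_lborel, of N] by (auto simp: N_def)
  define g where "g = (\<lambda>x. enn2real (g0 x))"
  have gm [measurable]: "g \<in> borel_measurable borel"
    using g0 unfolding g_def by simp
  have int: "(g has_integral (F b - F a)) {a..b}" if "a \<le> b" for a b
  proof -
    have img: "F ` {a..b} = {F a..F b}"
    proof
      show "F ` {a..b} \<subseteq> {F a..F b}" by (auto simp: monole)
      show "{F a..F b} \<subseteq> F ` {a..b}"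
      proof
        fix y assume "y \<in> {F a..F b}"
        then have "F a \<le> F (G y) \<and> F (G y) \<le> F b" by simp
        then have "a \<le> G y \<and> G y \<le> b" by (simp only: monole)
        then show "y \<in> F ` {a..b}"
          by (intro image_eqI[of _ _ "G y"]) simp_all
      qed
    qed
    have "(\<integral>\<^sup>+x. g0 x * indicator {a..b} x \<partial>lborel) = emeasure N {a..b}"
      unfolding dens[symmetric] by (subst emeasure_density) auto
    also have "\<dots> = ennreal (F b - F a)"
      using that by (simp add: emN img monole)
    finally have I: "(\<integral>\<^sup>+x. g0 x * indicator {a..b} x \<partial>lborel) = ennreal (F b - F a)" .
    have "AE x in lborel. g0 x * indicator {a..b} x \<noteq> \<infinity>"
      by (rule nn_integral_PInf_AE) (use I in auto)
    then have J: "(\<integral>\<^sup>+x. ennreal (g x * indicator {a..b} x) \<partial>lborel)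
        = (\<integral>\<^sup>+x. g0 x * indicator {a..b} x \<partial>lborel)"
      by (intro nn_integral_cong_AE, elim eventually_mono)
         (auto simp: g_def indicator_def less_top split: if_splits)
    have "((\<lambda>x. g x * indicator {a..b} x) has_integral (F b - F a)) UNIV"
    proof (rule nn_integral_has_integral)
      show "0 \<le> g x * indicator {a..b} x" for x by (simp add: g_def)
      show "0 \<le> F b - F a" using that by (simp add: monole)
    qed (use I J in simp_all)
    then have "((\<lambda>x. if x \<in> {a..b} then g x else 0) has_integral (F b - F a)) UNIV"
      by (rule has_integral_eq[rotated]) (auto simp: indicator_def)
    then show ?thesis
      by (simp only: has_integral_restrict_UNIV)
  qed
  have int': "((\<lambda>x. g (- x)) has_integral (F (-a) - F (-b))) {a..b}" if "a \<le> b" for a b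
    using int[of "-b" "-a"] that has_integral_reflect_real[of g "F (-a) - F (-b)" "-a" "-b"] by simp
  have "g integrable_on cbox a b" "(\<lambda>x. g (-x)) integrable_on cbox a b" for a b
    using int[of a b] int'[of a b] by (cases "a \<le> b"; auto simp: integrable_on_def)+
  note integrable = this
  \<comment> \<open>The differentiation theorem used here concerns averages over \<open>[x, x + h]\<close> only; applied to the
    reflection of \<open>g\<close> it yields the averages over \<open>[x - h, x]\<close>.\<close>
  obtain N1 where N1: "negligible N1"
    "\<And>x e. \<lbrakk>x \<notin> N1; 0 < e\<rbrakk> \<Longrightarrow> \<exists>d>0. \<forall>h. 0 < h \<and> h < d \<longrightarrow>
        norm (integral (cbox x (x + h *\<^sub>R One)) g /\<^sub>R h ^ DIM(real) - g x) < e"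
    using integrable_ccontinuous_explicit[OF integrable(1)] by metis
  obtain N2 where N2: "negligible N2"
    "\<And>x e. \<lbrakk>x \<notin> N2; 0 < e\<rbrakk> \<Longrightarrow> \<exists>d>0. \<forall>h. 0 < h \<and> h < d \<longrightarrow>
        norm (integral (cbox x (x + h *\<^sub>R One)) (\<lambda>x. g (-x)) /\<^sub>R h ^ DIM(real) - g (-x)) < e"
    using integrable_ccontinuous_explicit[OF integrable(2)] by metis
  have "negligible (uminus ` N2)"
    using N2(1) by (intro negligible_differentiable_image_negligible) auto
  then have neg: "negligible (N1 \<union> uminus ` N2)"
    using N1(1) by auto
  have "(F has_real_derivative g x) (at x)" if "x \<notin> N1 \<union> uminus ` N2" for x
    unfolding DERIV_def LIM_eq
  proof (intro allI impI)
    fix e :: real assume "0 < e"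
    have x: "x \<notin> N1" "- x \<notin> N2"
      using that by (auto simp: image_iff) 
    obtain d1 where d1: "d1 > 0" "\<And>h. 0 < h \<Longrightarrow> h < d1 \<Longrightarrow> \<bar>(F (x + h) - F x) / h - g x\<bar> < e"
      using N1(2)[OF x(1) \<open>0 < e\<close>] integral_unique[OF int]
      by (auto simp: divide_inverse mult.commute)
    obtain d2 where d2: "d2 > 0" "\<And>h. 0 < h \<Longrightarrow> h < d2 \<Longrightarrow> \<bar>(F x - F (x - h)) / h - g x\<bar> < e"
      using N2(2)[OF x(2) \<open>0 < e\<close>] integral_unique[OF int']
      by (auto simp: divide_inverse mult.commute)
    show "\<exists>s>0. \<forall>h. h \<noteq> 0 \<and> norm (h - 0) < s \<longrightarrow> norm ((F (x + h) - F x) / h - g x) < e"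
    proof (intro exI[of _ "min d1 d2"] conjI allI impI)
      fix h :: real assume h: "h \<noteq> 0 \<and> norm (h - 0) < min d1 d2"
      show "norm ((F (x + h) - F x) / h - g x) < e"
      proof (cases "h > 0")
        case True then show ?thesis using d1(2)[of h] h by auto
      next
        case False
        then have "(F (x + h) - F x) / h = (F x - F (x - (-h))) / (-h)"
          using h by (simp add: field_simps)
        then show ?thesis using d2(2)[of "-h"] h False by auto
      qed
    qed (use d1 d2 in auto)
  qed
  then have "AE x in lebesgue. (F has_real_derivative g x) (at x)"
    using neg by (intro AE_I'[of "N1 \<union> uminus ` N2"]) (auto simp: negligible_iff_null_sets)
  then show thesis using that gm by blast
qed

text \<open>One-dimensional Rademacher theorem: adding the linear function \<open>(L + 1) x\<close> makes any
  \<open>L\<close>-Lipschitz function expanding. The Borel function \<open>g\<close> is recorded because it gives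
  the measurability of the derivative.\<close>

lemma lipschitz_AE_differentiable:
  fixes f :: "real \<Rightarrow> real"
  assumes lip: "L-lipschitz_on UNIV f"
  obtains g where "g \<in> borel_measurable borel"
    "AE x in lebesgue. (f has_real_derivative g x) (at x)"
proof -
  define F where "F = (\<lambda>x. f x + (L + 1) * x)"
  have L0: "L \<ge> 0" using lip by (rule lipschitz_on_nonneg)
  have "(L + (L + 1) * 1)-lipschitz_on UNIV F"
    unfolding F_def using L0 by (intro lipschitz_intros lip) auto
  moreover have "y - x \<le> F y - F x" if "x \<le> y" for x y
    using lipschitz_onD[OF lip, of y x] that by (auto simp: F_def dist_real_def algebra_simps)
  ultimately obtain g where g: "g \<in> borel_measurable borel"
    "AE x in lebesgue. (F has_real_derivative g x) (at x)"
    by (rule expanding_lipschitz_AE_differentiable)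
  have "AE x in lebesgue. (f has_real_derivative g x - (L + 1)) (at x)"
    using g(2)
  proof eventually_elim
    case (elim x)
    have "((\<lambda>x. F x - (L + 1) * x) has_real_derivative g x - (L + 1)) (at x)"
      by (rule derivative_eq_intros elim refl | simp)+
    then show ?case by (simp add: F_def)
  qed
  then show thesis using that[of "\<lambda>x. g x - (L + 1)"] g(1) by simp
qed

section \<open>Arc length and bi-Lipschitz circle maps\<close>

lemma circle_dist_cis:
  assumes "\<bar>a - b\<bar> \<le> pi"
  shows "circle_dist (cis a) (cis b) = \<bar>a - b\<bar> / (2 * pi)"
proof (cases "b - a = - pi")
  case True
  then have "cis b / cis a = -1" by (simp only: cis_divide) (simp add: complex_eq_iff)
  moreover have "a - b = pi" using True by simp
  moreover have "Arg (-1) = pi" using Arg_cis[of pi] pi_gt_zero by simp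
  ultimately show ?thesis by (simp add: circle_dist_def)
next
  case False
  then have "Arg (cis (b - a)) = b - a" using assms by (intro Arg_cis) auto
  then show ?thesis by (simp add: circle_dist_def cis_divide)
qed

lemma circle_dist_cnj:
  assumes "\<zeta> \<in> unit_circle" "\<eta> \<in> unit_circle"
  shows "circle_dist (cnj \<zeta>) (cnj \<eta>) = circle_dist \<zeta> \<eta>"
  by (simp add: circle_dist_def Arg_cnj flip: complex_cnj_divide)

lemma chord_eq_sin:
  assumes "\<zeta> \<in> unit_circle" "\<eta> \<in> unit_circle"
  shows "dist \<zeta> \<eta> = 2 * \<bar>sin (Arg (\<eta> / \<zeta>) / 2)\<bar>"
proof -
  have n: "norm \<zeta> = 1" "norm \<eta> = 1" "\<zeta> \<noteq> 0" using assms by auto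
  have "\<eta> / \<zeta> = cis (Arg (\<eta> / \<zeta>))"
    using n by (subst cis_Arg) (auto simp: sgn_div_norm norm_divide)
  then have "norm (\<eta> / \<zeta> - 1) = 2 * \<bar>sin (Arg (\<eta> / \<zeta>) / 2)\<bar>"
    by (metis cis_conv_exp dist_exp_i_1)
  moreover have "norm (\<eta> / \<zeta> - 1) = dist \<zeta> \<eta>"
  proof -
    have "\<eta> / \<zeta> - 1 = (\<eta> - \<zeta>) / \<zeta>" using n(3) by (simp add: field_simps)
    then show ?thesis using n by (simp add: dist_norm norm_minus_commute norm_divide)
  qed
  ultimately show ?thesis by simp
qed

lemma chord_le_circle_dist:
  assumes "\<zeta> \<in> unit_circle" "\<eta> \<in> unit_circle"
  shows "dist \<zeta> \<eta> \<le> 2 * pi * circle_dist \<zeta> \<eta>"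
  using abs_sin_x_le_abs_x[of "Arg (\<eta> / \<zeta>) / 2"]
  by (simp add: chord_eq_sin[OF assms] circle_dist_def)

text \<open>Only some fixed constant matters here. With \<open>t\<close> a quarter of the angle, so \<open>t \<le> pi / 4\<close>,
  the chord is \<open>2 sin (2 t) = 4 sin t cos t\<close>, and \<open>cos \<ge> 1 / 2\<close> on \<open>[0, pi / 3]\<close> controls both
  factors.\<close>

lemma circle_dist_le_chord:
  assumes "\<zeta> \<in> unit_circle" "\<eta> \<in> unit_circle"
  shows "2 * pi * circle_dist \<zeta> \<eta> \<le> 4 * dist \<zeta> \<eta>"
proof -
  define t where "t = \<bar>Arg (\<eta> / \<zeta>)\<bar> / 4"
  have t: "0 \<le> t" "t \<le> pi / 4"
    using Arg_bounded[of "\<eta> / \<zeta>"] by (auto simp: t_def)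
  have "cos (pi/3) \<le> cos t"
    using t pi_gt_zero by (intro cos_monotone_0_pi_le) auto
  then have cost: "1/2 \<le> cos t" by (simp add: cos_60)
  have sint: "t / 2 \<le> sin t"
  proof (cases "t = 0")
    case False
    then have "\<exists>z. 0 < z \<and> z < t \<and> sin t - sin 0 = (t - 0) * cos z"
      using t by (intro MVT2) (auto intro!: derivative_eq_intros)
    then obtain z where z: "0 < z" "z < t" "sin t = t * cos z" by auto
    have "cos (pi/3) \<le> cos z"
      using t z pi_gt_zero by (intro cos_monotone_0_pi_le) auto
    then have "t * (1/2) \<le> t * cos z" using t by (intro mult_left_mono) (auto simp: cos_60)
    then show ?thesis using z by simp
  qed simp
  have "t / 2 * (1/2) \<le> sin t * cos t"
    using cost sint t by (intro mult_mono) auto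
  then have "t / 2 \<le> sin (2 * t)" by (simp add: sin_double)
  also have "\<dots> \<le> \<bar>sin (Arg (\<eta> / \<zeta>) / 2)\<bar>"
    by (auto simp: t_def abs_if)
  finally have "t / 2 \<le> dist \<zeta> \<eta> / 2"
    using chord_eq_sin[OF assms] by simp
  then show ?thesis by (simp add: t_def circle_dist_def)
qed

definition bilipschitz_on_circle :: "real \<Rightarrow> (complex \<Rightarrow> complex) \<Rightarrow> bool" where
  "bilipschitz_on_circle L h \<longleftrightarrow> 1 \<le> L \<and> (\<forall>\<zeta>\<in>unit_circle. \<forall>\<eta>\<in>unit_circle.
     circle_dist \<zeta> \<eta> / L \<le> circle_dist (h \<zeta>) (h \<eta>) \<and>
     circle_dist (h \<zeta>) (h \<eta>) \<le> L * circle_dist \<zeta> \<eta>)"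

lemma bilipschitz_on_circleD:
  assumes "bilipschitz_on_circle L h"
  shows "1 \<le> L"
    and "\<lbrakk>\<zeta> \<in> unit_circle; \<eta> \<in> unit_circle\<rbrakk> \<Longrightarrow> circle_dist \<zeta> \<eta> / L \<le> circle_dist (h \<zeta>) (h \<eta>)"
    and "\<lbrakk>\<zeta> \<in> unit_circle; \<eta> \<in> unit_circle\<rbrakk> \<Longrightarrow> circle_dist (h \<zeta>) (h \<eta>) \<le> L * circle_dist \<zeta> \<eta>"
  using assms by (simp_all add: bilipschitz_on_circle_def)

lemma BiLip_circle_iff:
  "h \<in> BiLip_circle \<longleftrightarrow>
     (\<exists>g. homeomorphism unit_circle unit_circle h g) \<and> (\<exists>L. bilipschitz_on_circle L h)"
  by (simp add: BiLip_circle_def self_homeomorphism_def bilipschitz_on_circle_def)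

lemma BiLip_circle_maps_circle:
  assumes "h \<in> BiLip_circle"
  shows "continuous_on unit_circle h" "h ` unit_circle = unit_circle" "inj_on h unit_circle"
proof -
  obtain g where "homeomorphism unit_circle unit_circle h g"
    using assms unfolding BiLip_circle_iff by blast
  then show "continuous_on unit_circle h" "h ` unit_circle = unit_circle" "inj_on h unit_circle"
    by (auto simp: homeomorphism_def intro: inj_on_inverseI)
qed

lemma BiLip_circle_inverse:
  assumes h: "h \<in> BiLip_circle"
  obtains g where "g \<in> BiLip_circle" "homeomorphism unit_circle unit_circle h g"
proof -
  obtain g where g: "homeomorphism unit_circle unit_circle h g"
    using h unfolding BiLip_circle_iff by blast
  then have g': "homeomorphism unit_circle unit_circle g h" by (rule homeomorphism_symD)
  have gS: "g \<zeta> \<in> unit_circle" "h (g \<zeta>) = \<zeta>" if "\<zeta> \<in> unit_circle" for \<zeta>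
    using g that homeomorphism_image2 homeomorphism_apply2 by blast+
  obtain L where bl: "bilipschitz_on_circle L h"
    using h unfolding BiLip_circle_iff by blast
  note L = bilipschitz_on_circleD[OF bl]
  have "bilipschitz_on_circle L g"
    unfolding bilipschitz_on_circle_def
  proof (intro conjI ballI L(1))
    fix \<zeta> \<eta> assume S: "\<zeta> \<in> unit_circle" "\<eta> \<in> unit_circle"
    note * = L(2,3)[OF gS(1)[OF S(1)] gS(1)[OF S(2)], unfolded gS(2)[OF S(1)] gS(2)[OF S(2)]]
    show "circle_dist \<zeta> \<eta> / L \<le> circle_dist (g \<zeta>) (g \<eta>)"
      "circle_dist (g \<zeta>) (g \<eta>) \<le> L * circle_dist \<zeta> \<eta>"
      using * L(1) by (simp_all add: field_simps)
  qed
  then have "g \<in> BiLip_circle"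
    using g' unfolding BiLip_circle_iff by blast
  then show thesis using that g by blast
qed

lemma BiLip_circle_cnj:
  assumes "h \<in> BiLip_circle"
  shows "h \<circ> cnj \<in> BiLip_circle"
proof -
  obtain g where g: "homeomorphism unit_circle unit_circle h g"
    using assms unfolding BiLip_circle_iff by blast
  have "homeomorphism unit_circle unit_circle cnj cnj"
    by (intro homeomorphismI continuous_intros) auto
  then have hom: "homeomorphism unit_circle unit_circle (h \<circ> cnj) (cnj \<circ> g)"
    using g by (rule homeomorphism_compose)
  obtain L where bl: "bilipschitz_on_circle L h"
    using assms unfolding BiLip_circle_iff by blast
  note L = bilipschitz_on_circleD[OF bl]
  have "bilipschitz_on_circle L (h \<circ> cnj)"
    unfolding bilipschitz_on_circle_def
  proof (intro conjI ballI L(1))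
    fix \<zeta> \<eta> assume S: "\<zeta> \<in> unit_circle" "\<eta> \<in> unit_circle"
    then have "cnj \<zeta> \<in> unit_circle" "cnj \<eta> \<in> unit_circle" by auto
    from L(2,3)[OF this]
    show "circle_dist \<zeta> \<eta> / L \<le> circle_dist ((h \<circ> cnj) \<zeta>) ((h \<circ> cnj) \<eta>)"
      "circle_dist ((h \<circ> cnj) \<zeta>) ((h \<circ> cnj) \<eta>) \<le> L * circle_dist \<zeta> \<eta>"
      by (simp_all add: circle_dist_cnj[OF S])
  qed
  then show ?thesis
    using hom unfolding BiLip_circle_iff by blast
qed

text \<open>The radial extension is compared with the Euclidean metric of the plane, hence the passage from
  arcs to chords.\<close>

lemma BiLip_circle_chord_lipschitz:
  assumes "h \<in> BiLip_circle"
  obtains M where "M-lipschitz_on unit_circle h"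
proof -
  obtain L where bl: "bilipschitz_on_circle L h"
    using assms unfolding BiLip_circle_iff by blast
  note L = bilipschitz_on_circleD[OF bl]
  have hS: "h \<zeta> \<in> unit_circle" if "\<zeta> \<in> unit_circle" for \<zeta>
    using BiLip_circle_maps_circle(2)[OF assms] that by blast
  have "(4 * L)-lipschitz_on unit_circle h"
  proof (rule lipschitz_onI)
    fix \<zeta> \<eta> assume S: "\<zeta> \<in> unit_circle" "\<eta> \<in> unit_circle"
    have "dist (h \<zeta>) (h \<eta>) \<le> 2 * pi * circle_dist (h \<zeta>) (h \<eta>)"
      using S hS by (intro chord_le_circle_dist)
    also have "\<dots> \<le> 2 * pi * (L * circle_dist \<zeta> \<eta>)"
      using L(3)[OF S] by (intro mult_left_mono) auto
    also have "\<dots> = L * (2 * pi * circle_dist \<zeta> \<eta>)" by simp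
    also have "\<dots> \<le> L * (4 * dist \<zeta> \<eta>)"
      using circle_dist_le_chord[OF S] L(1) by (intro mult_left_mono) auto
    finally show "dist (h \<zeta>) (h \<eta>) \<le> 4 * L * dist \<zeta> \<eta>" by simp
  qed (use L(1) in simp)
  then show thesis by (rule that)
qed

section \<open>Lifts\<close>

text \<open>As long as \<open>\<bar>x - y\<bar>\<close> and \<open>\<bar>H x - H y\<bar>\<close> are at most \<open>pi\<close>, both are arc lengths up to the common
  factor \<open>2 pi\<close>, and the hypothesis on \<open>h\<close> applies verbatim. Thus it suffices to show that \<open>H\<close> cannot
  move by \<open>pi\<close> on an interval of length less than \<open>pi / L\<close>; this is where continuity of \<open>H\<close> enters.\<close>

lemma lift_locally_bilipschitz:
  assumes h: "h \<in> BiLip_circle" and H: "is_lift h H"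
  obtains L where "L \<ge> 1"
    "\<And>x y. L * \<bar>x - y\<bar> < pi \<Longrightarrow> \<bar>x - y\<bar> / L \<le> \<bar>H x - H y\<bar> \<and> \<bar>H x - H y\<bar> \<le> L * \<bar>x - y\<bar>"
proof -
  obtain L where bl: "bilipschitz_on_circle L h"
    using h unfolding BiLip_circle_iff by blast
  note L = bilipschitz_on_circleD[OF bl]
  have Hh: "\<And>x. h (cis x) = cis (H x)" and contH: "continuous_on UNIV H"
    using H by (auto simp: is_lift_def)
  have dist_small: "\<bar>x - y\<bar> \<le> pi" if "L * \<bar>x - y\<bar> < pi" for x y
    using that mult_right_mono[OF L(1), of "\<bar>x - y\<bar>"] by simp
  have le: "\<bar>x - y\<bar> / L \<le> \<bar>H x - H y\<bar> \<and> \<bar>H x - H y\<bar> \<le> L * \<bar>x - y\<bar>"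
    if "L * \<bar>x - y\<bar> < pi" "\<bar>H x - H y\<bar> \<le> pi" for x y
  proof -
    have d: "circle_dist (cis x) (cis y) = \<bar>x - y\<bar> / (2 * pi)"
      "circle_dist (h (cis x)) (h (cis y)) = \<bar>H x - H y\<bar> / (2 * pi)"
      using that dist_small[OF that(1)] by (simp_all add: circle_dist_cis Hh)
    show ?thesis
      using L(2,3)[of "cis x" "cis y", unfolded d] L(1) by (simp add: field_simps)
  qed
  \<comment> \<open>otherwise \<open>\<bar>H x - H s\<bar> = pi\<close> at some intermediate point \<open>s\<close>, whose image is antipodal to that of
    \<open>x\<close> although \<open>s\<close> is closer to \<open>x\<close> than \<open>pi / L\<close>\<close>
  have lt: "\<bar>H x - H y\<bar> < pi" if xy: "x \<le> y" "L * \<bar>x - y\<bar> < pi" for x y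
  proof (rule ccontr)
    assume "\<not> ?thesis"
    then have "\<bar>H x - H x\<bar> \<le> pi" "pi \<le> \<bar>H x - H y\<bar>" by auto
    moreover have "continuous_on {x..y} (\<lambda>s. \<bar>H x - H s\<bar>)"
      by (intro continuous_intros continuous_on_subset[OF contH]) auto
    ultimately obtain s where s: "x \<le> s" "s \<le> y" "\<bar>H x - H s\<bar> = pi"
      using IVT'[of "\<lambda>s. \<bar>H x - H s\<bar>" x pi y] xy(1) by auto
    have "L * \<bar>x - s\<bar> \<le> L * \<bar>x - y\<bar>"
      using s L(1) by (intro mult_left_mono) auto
    then have "L * \<bar>x - s\<bar> < pi" using xy(2) by simp
    then show False using le[of x s] s(3) by simp
  qed
  show thesis
  proof (rule that[OF L(1)])
    fix x y assume *: "L * \<bar>x - y\<bar> < pi"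
    show "\<bar>x - y\<bar> / L \<le> \<bar>H x - H y\<bar> \<and> \<bar>H x - H y\<bar> \<le> L * \<bar>x - y\<bar>"
    proof (rule le[OF *])
      show "\<bar>H x - H y\<bar> \<le> pi"
        using lt[of x y] lt[of y x] * by (cases "x \<le> y") (auto simp: abs_minus_commute)
    qed
  qed
qed

lemma lift_lipschitz:
  assumes h: "h \<in> BiLip_circle" and H: "is_lift h H"
  obtains L where "L-lipschitz_on UNIV H"
proof -
  obtain L where L: "L \<ge> 1"
    "\<And>x y. L * \<bar>x - y\<bar> < pi \<Longrightarrow> \<bar>x - y\<bar> / L \<le> \<bar>H x - H y\<bar> \<and> \<bar>H x - H y\<bar> \<le> L * \<bar>x - y\<bar>"
    using lift_locally_bilipschitz[OF h H] by blast
  have contH: "continuous_on UNIV H"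
    using H by (auto simp: is_lift_def)
  have lip: "L-lipschitz_on {a..b} H" for a b
  proof (rule locally_lipschitz_imp_lipschitz)
    show "continuous_on {a..b} H" using contH continuous_on_subset by blast
    fix x y :: real assume "x \<in> {a..<b}" "y > x"
    \<comment> \<open>a point within the range \<open>pi / L\<close> of the local estimate\<close>
    define z where "z = min y (x + pi / (2 * L))"
    have z: "x < z" "z \<le> y" "z - x \<le> pi / (2 * L)"
      using \<open>y > x\<close> L(1) by (auto simp: z_def)
    then have "L * \<bar>z - x\<bar> \<le> L * (pi / (2 * L))"
      using L(1) by (intro mult_left_mono) auto
    also have "\<dots> < pi" using L(1) by simp
    finally show "\<exists>z\<in>{x<..y}. dist (H z) (H x) \<le> L * (z - x)"
      using L(2)[of z x] z by (intro bexI[of _ z]) (auto simp: dist_real_def)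
  qed (use L in auto)
  have "L-lipschitz_on UNIV H"
  proof (rule lipschitz_onI)
    fix x y show "dist (H x) (H y) \<le> L * dist x y"
      using lipschitz_onD[OF lip[of "min x y" "max x y"], of x y] by auto
  qed (use L in auto)
  then show thesis by (rule that)
qed

text \<open>The difference quotients inherit the local bi-Lipschitz bounds. In particular the
  derivative of a lift is bounded away from \<open>0\<close>, which makes the essential supremum finite.\<close>

lemma lift_deriv_bounds:
  assumes h: "h \<in> BiLip_circle" and H: "is_lift h H"
  obtains L where "L \<ge> 1"
    "\<And>x D. (H has_real_derivative D) (at x) \<Longrightarrow> 1 / L \<le> \<bar>D\<bar> \<and> \<bar>D\<bar> \<le> L"
proof -
  obtain L where L: "L \<ge> 1"
    "\<And>x y. L * \<bar>x - y\<bar> < pi \<Longrightarrow> \<bar>x - y\<bar> / L \<le> \<bar>H x - H y\<bar> \<and> \<bar>H x - H y\<bar> \<le> L * \<bar>x - y\<bar>"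
    using lift_locally_bilipschitz[OF h H] by blast
  show thesis
  proof (rule that[OF L(1)])
    fix x D assume "(H has_real_derivative D) (at x)"
    then have lim: "((\<lambda>t. \<bar>(H (x + t) - H x) / t\<bar>) \<longlongrightarrow> \<bar>D\<bar>) (at 0)"
      unfolding DERIV_def by (rule tendsto_rabs)
    have "eventually (\<lambda>t::real. t \<noteq> 0 \<and> \<bar>t\<bar> < pi / L) (at 0)"
      unfolding eventually_at using L(1) by (intro exI[of _ "pi / L"]) auto
    then have ev: "\<forall>\<^sub>F t in at 0. 1 / L \<le> \<bar>(H (x + t) - H x) / t\<bar> \<and> \<bar>(H (x + t) - H x) / t\<bar> \<le> L"
    proof eventually_elim
      case (elim t)
      then have "L * \<bar>(x + t) - x\<bar> < pi" using L(1) by (simp add: field_simps)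
      from L(2)[OF this] show ?case using elim L(1) by (simp add: field_simps abs_divide)
    qed
    show "1 / L \<le> \<bar>D\<bar> \<and> \<bar>D\<bar> \<le> L"
    proof
      show "1 / L \<le> \<bar>D\<bar>"
        by (rule tendsto_lowerbound[OF lim]) (use ev in \<open>auto elim: eventually_mono\<close>)
      show "\<bar>D\<bar> \<le> L"
        by (rule tendsto_upperbound[OF lim]) (use ev in \<open>auto elim: eventually_mono\<close>)
    qed
  qed
qed

lemma lift_AE_differentiable:
  assumes h: "h \<in> BiLip_circle" and H: "is_lift h H"
  shows "AE \<theta> in lebesgue. (H has_real_derivative deriv H \<theta>) (at \<theta>)"
    and "deriv H \<in> borel_measurable lebesgue"
proof -
  obtain L where "L-lipschitz_on UNIV H" using lift_lipschitz[OF h H] .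
  then obtain g where g: "g \<in> borel_measurable borel"
    "AE \<theta> in lebesgue. (H has_real_derivative g \<theta>) (at \<theta>)"
    by (rule lipschitz_AE_differentiable)
  show "AE \<theta> in lebesgue. (H has_real_derivative deriv H \<theta>) (at \<theta>)"
    using g(2) by eventually_elim (metis DERIV_imp_deriv)
  have "AE \<theta> in lebesgue. g \<theta> = deriv H \<theta>"
    using g(2) by eventually_elim (metis DERIV_imp_deriv)
  moreover have "g \<in> borel_measurable lebesgue"
    using g(1) by (intro measurable_completion) simp
  ultimately show "deriv H \<in> borel_measurable lebesgue"
    by (rule borel_measurable_AE[rotated])
qed

text \<open>The image of the circle is a simple closed curve around \<open>0\<close>, so every circle homeomorphism
  either preserves or reverses orientation.\<close>

lemma winding_number_circle_homeomorphism:
  assumes h: "h \<in> BiLip_circle"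
  shows "winding_number (h \<circ> circlepath 0 1) 0 = 1 \<or> winding_number (h \<circ> circlepath 0 1) 0 = -1"
proof -
  note hS = BiLip_circle_maps_circle[OF h]
  have simple: "simple_path (h \<circ> circlepath 0 1)"
    using hS by (intro simple_path_continuous_image) (auto simp: simple_path_circlepath)
  have "0 \<in> inside (frontier (cball (0::complex) 1))"
    using interior_inside_frontier[of "cball (0::complex) 1"] by auto
  then have "0 \<in> inside (path_image (h \<circ> circlepath 0 1))"
    by (simp add: path_image_compose hS(2))
  then show ?thesis
    using simple_closed_path_winding_number_inside[OF simple] by blast
qed

lemma lift_winding_number:
  assumes H: "is_lift h H"
  shows "winding_number (h \<circ> circlepath 0 1) 0 = of_real ((H (2 * pi) - H 0) / (2 * pi))"
proof -
  have Hh: "\<And>x. h (cis x) = cis (H x)" and contH: "continuous_on UNIV H"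
    using H by (auto simp: is_lift_def)
  define p where "p = (\<lambda>x::real. \<i> * of_real (H (2 * pi * x)))"
  have "path p"
    unfolding path_def p_def
    by (intro continuous_intros continuous_on_compose2[OF contH]) auto
  then have "winding_number (exp \<circ> p) 0 = (pathfinish p - pathstart p) / (2 * of_real pi * \<i>)"
    by (rule winding_number_compose_exp)
  moreover have "exp \<circ> p = h \<circ> circlepath 0 1"
  proof
    fix x
    have "circlepath 0 1 x = cis (2 * pi * x)"
      by (simp add: circlepath cis_conv_exp mult_ac)
    then have "(h \<circ> circlepath 0 1) x = cis (H (2 * pi * x))"
      by (simp only: o_apply Hh)
    then show "(exp \<circ> p) x = (h \<circ> circlepath 0 1) x"
      by (simp add: p_def cis_conv_exp)
  qed
  moreover have "(\<i> * of_real a - \<i> * of_real b) / (2 * of_real pi * \<i>) = of_real ((a - b) / (2 * pi))"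
    for a b :: real by (simp add: field_simps)
  ultimately show ?thesis
    by (simp add: p_def pathfinish_def pathstart_def)
qed

text \<open>The increment \<open>D x = H (x + 2 pi) - H x\<close> is continuous with values in \<open>2 pi \<int>\<close>, hence
  constant, and the degree fixes it to be \<open>2 pi\<close>. Equal values of \<open>H\<close> at two points
  therefore force the points to coincide (they differ by a period by injectivity of \<open>h\<close>), and a
  continuous injective function with \<open>H (x + 2 pi n) > H x\<close> is increasing.\<close>

lemma lift_strict_mono:
  assumes h: "h \<in> BiLip_circle" and H: "is_lift h H"
    and w: "winding_number (h \<circ> circlepath 0 1) 0 = 1"
  shows "strict_mono H"
proof -
  have Hh: "\<And>x. h (cis x) = cis (H x)" and contH: "continuous_on UNIV H"
    using H by (auto simp: is_lift_def)
  have same: "\<exists>n::int. u - v = of_int n * 2 * pi" if "cis u = cis v" for u v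
  proof -
    have "cis (u - v) = 1" using that by (simp flip: cis_divide)
    then have "cos (u - v) = 1" by (simp add: complex_eq_iff)
    then show ?thesis by (simp add: cos_one_2pi_int)
  qed
  define D where "D = (\<lambda>x. H (x + 2 * pi) - H x)"
  have disc: "\<exists>n::int. D x = of_int n * 2 * pi" for x
  proof -
    have "cis (x + 2 * pi) = cis x"
      by (simp add: complex_eq_iff)
    then have "cis (H (x + 2 * pi)) = cis (H x)"
      by (simp only: Hh[symmetric])
    then show ?thesis unfolding D_def by (rule same)
  qed
  have "D constant_on UNIV"
  proof (rule continuous_discrete_range_constant)
    show "continuous_on UNIV D"
      unfolding D_def by (intro continuous_intros continuous_on_compose2[OF contH]) auto
    fix x
    show "\<exists>e>0. \<forall>y. y \<in> UNIV \<and> D y \<noteq> D x \<longrightarrow> e \<le> norm (D y - D x)"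
    proof (intro exI[of _ "2 * pi"] conjI allI impI)
      fix y assume y: "y \<in> UNIV \<and> D y \<noteq> D x"
      obtain m n :: int where mn: "D y = of_int m * 2 * pi" "D x = of_int n * 2 * pi"
        using disc by metis
      then have "m \<noteq> n" using y by auto
      then have "1 \<le> \<bar>m - n\<bar>" by linarith
      then have "1 \<le> \<bar>of_int m - of_int n :: real\<bar>" by linarith
      then have "1 * (2 * pi) \<le> \<bar>of_int m - of_int n\<bar> * (2 * pi)" by (intro mult_right_mono) auto
      also have "\<dots> = norm ((of_int m - of_int n) * (2 * pi))" by (simp add: abs_mult)
      also have "(of_int m - of_int n) * (2 * pi) = D y - D x" by (simp add: mn algebra_simps)
      finally show "2 * pi \<le> norm (D y - D x)" by simp
    qed auto
  qed simp
  moreover have "D 0 = 2 * pi"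
    using w unfolding lift_winding_number[OF H] D_def by (simp add: field_simps flip: of_real_diff of_real_divide)
  ultimately have "D x = 2 * pi" for x
    unfolding constant_on_def by auto
  then have period: "H (x + 2 * pi) = H x + 2 * pi" for x
    unfolding D_def by (simp add: algebra_simps)
  have period_nat: "H (x + of_nat n * 2 * pi) = H x + of_nat n * 2 * pi" for x n
  proof (induction n)
    case (Suc n)
    then show ?case
      using period[of "x + of_nat n * 2 * pi"] by (simp add: algebra_simps)
  qed simp
  have inj: "inj H"
  proof (rule injI)
    have *: "x = y" if eq: "H x = H y" and le: "x \<le> y" for x y
    proof -
      have "h (cis x) = h (cis y)" using eq by (simp add: Hh)
      then have "cis y = cis x"
        using BiLip_circle_maps_circle(3)[OF h] by (auto dest: inj_onD)
      then obtain n :: int where n: "y - x = of_int n * 2 * pi" using same by blast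
      have "0 \<le> of_int n * (2 * pi)" using n le by linarith
      then have "0 \<le> n" using pi_gt_zero by (auto simp: zero_le_mult_iff)
      then have y: "y = x + of_nat (nat n) * 2 * pi" using n by simp
      have "H y = H x + of_nat (nat n) * 2 * pi" unfolding y by (rule period_nat)
      then show ?thesis using eq y by simp
    qed
    fix x y assume "H x = H y"
    then show "x = y" using *[of x y] *[of y x] by (cases "x \<le> y") auto
  qed
  show ?thesis
  proof (rule strict_monoI)
    fix x y :: real assume xy: "x < y"
    obtain n :: nat where "(y - x) / (2 * pi) < of_nat n" using reals_Archimedean2 by blast
    then have n: "y < x + of_nat n * 2 * pi" by (simp add: field_simps)
    then have "H x < H (x + of_nat n * 2 * pi)"
      unfolding period_nat using xy by linarith
    moreover have "(H x < H y \<and> H y < H (x + of_nat n * 2 * pi)) \<or> (H (x + of_nat n * 2 * pi) < H y \<and> H y < H x)"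
      using contH inj xy n by (intro continuous_inj_imp_mono) (auto intro: continuous_on_subset inj_on_subset)
    ultimately show "H x < H y" by auto
  qed
qed

section \<open>The radial extension\<close>

lemma radial_extension_0 [simp]: "radial_extension h 0 = 0"
  by (simp add: radial_extension_def)

lemma radial_extension_polar:
  assumes "\<zeta> \<in> unit_circle" "0 \<le> r"
  shows "radial_extension h (of_real r * \<zeta>) = of_real r * h \<zeta>"
proof -
  have "norm \<zeta> = 1" "\<zeta> \<noteq> 0" using assms by auto
  then show ?thesis using assms(2) by (simp add: radial_extension_def norm_mult)
qed

lemma polar_form:
  obtains \<zeta> :: complex where "\<zeta> \<in> unit_circle" "z = of_real (norm z) * \<zeta>"
proof (cases "z = 0")
  case True then show ?thesis using that[of 1] by simp
next
  case False
  then show ?thesis using that[of "z / of_real (norm z)"] by (simp add: norm_divide)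
qed

lemma norm_radial_extension:
  assumes "h ` unit_circle \<subseteq> unit_circle"
  shows "norm (radial_extension h z) = norm z"
proof -
  obtain \<zeta> where \<zeta>: "\<zeta> \<in> unit_circle" "z = of_real (norm z) * \<zeta>" by (rule polar_form)
  then have "h \<zeta> \<in> unit_circle" using assms by blast
  then have "norm (h \<zeta>) = 1" by simp
  moreover have "radial_extension h z = of_real (norm z) * h \<zeta>"
    using radial_extension_polar[OF \<zeta>(1), of "norm z" h] \<zeta>(2) by simp
  ultimately show ?thesis by (simp add: norm_mult)
qed

lemma radial_extension_inverse:
  assumes h: "h ` unit_circle \<subseteq> unit_circle"
    and gh: "\<And>\<zeta>. \<zeta> \<in> unit_circle \<Longrightarrow> g (h \<zeta>) = \<zeta>"
  shows "radial_extension g (radial_extension h z) = z"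
proof -
  obtain \<zeta> where \<zeta>: "\<zeta> \<in> unit_circle" "z = of_real (norm z) * \<zeta>" by (rule polar_form)
  have "radial_extension h z = of_real (norm z) * h \<zeta>"
    using radial_extension_polar[OF \<zeta>(1), of "norm z" h] \<zeta>(2) by simp
  moreover have "h \<zeta> \<in> unit_circle" using h \<zeta>(1) by blast
  ultimately show ?thesis
    using radial_extension_polar[of "h \<zeta>" "norm z" g] gh[OF \<zeta>(1)] \<zeta>(2) by simp
qed

lemma radial_extension_comp_cnj:
  "radial_extension h \<circ> cnj = radial_extension (h \<circ> cnj)"
  by (auto simp: radial_extension_def fun_eq_iff)

text \<open>In the coordinates \<open>z = exp w\<close> the radial extension is
  \<open>s + i t \<mapsto> s + i H t\<close>, which reduces every infinitesimal computation to one variable.\<close>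

lemma radial_extension_exp:
  assumes "is_lift h H"
  shows "radial_extension h (exp w) = exp (Complex (Re w) (H (Im w)))"
proof -
  have "exp w = of_real (exp (Re w)) * cis (Im w)"
    by (simp add: exp_eq_polar)
  moreover have "h (cis (Im w)) = cis (H (Im w))" using assms by (simp add: is_lift_def)
  moreover have "exp (Complex (Re w) (H (Im w))) = of_real (exp (Re w)) * cis (H (Im w))"
    by (simp add: exp_eq_polar)
  ultimately show ?thesis
    using radial_extension_polar[of "cis (Im w)" "exp (Re w)" h] by simp
qed

text \<open>For \<open>z = r \<zeta>\<close> and \<open>w = s \<eta>\<close> the difference of the images splits into a radial part
  \<open>(r - s) h \<zeta>\<close> and an angular part \<open>s (h \<zeta> - h \<eta>)\<close>. The latter is at most \<open>M s \<bar>\<zeta> - \<eta>\<bar>\<close>, and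
  \<open>s \<bar>\<zeta> - \<eta>\<bar> \<le> 2 \<bar>z - w\<bar>\<close> by moving \<open>z\<close> radially to the circle of radius \<open>s\<close>.\<close>

lemma radial_extension_lipschitz:
  assumes h: "h ` unit_circle \<subseteq> unit_circle" and lip: "M-lipschitz_on unit_circle h"
  shows "(1 + 2 * M)-lipschitz_on UNIV (radial_extension h)"
proof (rule lipschitz_onI)
  have M: "0 \<le> M" using lip by (rule lipschitz_on_nonneg)
  then show "0 \<le> 1 + 2 * M" by simp
  fix z w :: complex
  obtain \<zeta> where \<zeta>: "\<zeta> \<in> unit_circle" "z = of_real (norm z) * \<zeta>" by (rule polar_form)
  obtain \<eta> where \<eta>: "\<eta> \<in> unit_circle" "w = of_real (norm w) * \<eta>" by (rule polar_form)
  define r where "r = norm z"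
  define s where "s = norm w"
  have s: "0 \<le> s" by (simp add: s_def)
  have "h \<zeta> \<in> unit_circle" using \<zeta>(1) h by blast
  then have n: "norm \<zeta> = 1" "norm (h \<zeta>) = 1" using \<zeta>(1) by simp_all
  have z: "z = of_real r * \<zeta>" and w: "w = of_real s * \<eta>"
    using \<zeta> \<eta> by (simp_all add: r_def s_def)
  have E: "radial_extension h z = of_real r * h \<zeta>" "radial_extension h w = of_real s * h \<eta>"
    unfolding z w using \<zeta>(1) \<eta>(1) by (auto simp: r_def s intro!: radial_extension_polar)
  have rs: "\<bar>r - s\<bar> \<le> norm (z - w)"
    by (simp add: r_def s_def norm_triangle_ineq3)
  have "of_real s * (\<zeta> - \<eta>) = of_real (s - r) * \<zeta> + (z - w)"
    by (simp add: z w algebra_simps)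
  then have "norm (of_real s * (\<zeta> - \<eta>)) \<le> norm (of_real (s - r) * \<zeta>) + norm (z - w)"
    by (metis norm_triangle_ineq)
  then have "s * norm (\<zeta> - \<eta>) \<le> \<bar>s - r\<bar> + norm (z - w)"
    unfolding norm_mult norm_of_real n using s by simp
  then have chord: "s * norm (\<zeta> - \<eta>) \<le> 2 * norm (z - w)"
    using rs by linarith
  have "radial_extension h z - radial_extension h w
      = of_real (r - s) * h \<zeta> + of_real s * (h \<zeta> - h \<eta>)"
    by (simp add: E algebra_simps)
  then have "norm (radial_extension h z - radial_extension h w)
      \<le> norm (of_real (r - s) * h \<zeta>) + norm (of_real s * (h \<zeta> - h \<eta>))"
    by (metis norm_triangle_ineq)
  also have "\<dots> = \<bar>r - s\<bar> + s * norm (h \<zeta> - h \<eta>)"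
    unfolding norm_mult norm_of_real n using s by simp
  also have "\<dots> \<le> norm (z - w) + s * (M * norm (\<zeta> - \<eta>))"
    using rs s lipschitz_on_normD[OF lip \<zeta>(1) \<eta>(1)] by (intro add_mono mult_left_mono) auto
  also have "\<dots> \<le> norm (z - w) + M * (2 * norm (z - w))"
    using mult_left_mono[OF chord M] by (simp add: mult_ac)
  finally show "dist (radial_extension h z) (radial_extension h w) \<le> (1 + 2 * M) * dist z w"
    by (simp add: dist_norm algebra_simps)
qed

text \<open>Radial extension is functorial, so the extension of the inverse circle map is the inverse; both
  extensions are Lipschitz, hence continuous.\<close>

lemma self_homeomorphism_radial_extension:
  assumes h: "h \<in> BiLip_circle"
  shows "self_homeomorphism unit_disc (radial_extension h)"
proof -
  obtain g where g: "g \<in> BiLip_circle" "homeomorphism unit_circle unit_circle h g"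
    using BiLip_circle_inverse[OF h] .
  have hS: "h ` unit_circle \<subseteq> unit_circle" "g ` unit_circle \<subseteq> unit_circle"
    and inv: "\<And>\<zeta>. \<zeta> \<in> unit_circle \<Longrightarrow> g (h \<zeta>) = \<zeta>" "\<And>\<zeta>. \<zeta> \<in> unit_circle \<Longrightarrow> h (g \<zeta>) = \<zeta>"
    using g(2) by (auto simp: homeomorphism_def)
  obtain M where "M-lipschitz_on unit_circle h" using BiLip_circle_chord_lipschitz[OF h] .
  then have "continuous_on UNIV (radial_extension h)"
    using radial_extension_lipschitz hS(1) lipschitz_on_continuous_on by blast
  moreover obtain M' where "M'-lipschitz_on unit_circle g" using BiLip_circle_chord_lipschitz[OF g(1)] .
  then have "continuous_on UNIV (radial_extension g)"
    using radial_extension_lipschitz hS(2) lipschitz_on_continuous_on by blast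
  moreover have "radial_extension g (radial_extension h z) = z" "radial_extension h (radial_extension g z) = z" for z
    using radial_extension_inverse[OF hS(1) inv(1)] radial_extension_inverse[OF hS(2) inv(2)] by simp_all
  ultimately have "homeomorphism unit_disc unit_disc (radial_extension h) (radial_extension g)"
    by (intro homeomorphismI)
       (auto intro: continuous_on_subset simp: norm_radial_extension[OF hS(1)] norm_radial_extension[OF hS(2)])
  then show ?thesis unfolding self_homeomorphism_def by blast
qed

section \<open>Absolute continuity on lines\<close>

lemma lipschitz_imp_abs_continuous_on:
  assumes lip: "C-lipschitz_on UNIV f"
  shows "abs_continuous_on S f"
  unfolding abs_continuous_on_def
proof (intro allI impI)
  fix e :: real assume "0 < e"
  have C: "0 \<le> C" using lip by (rule lipschitz_on_nonneg)
  show "\<exists>\<delta>>0. \<forall>\<D>. \<D> division_of \<Union>\<D> \<and> \<Union>\<D> \<subseteq> S \<and> (\<Sum>k\<in>\<D>. Sup k - Inf k) < \<delta> \<longrightarrow>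
      (\<Sum>k\<in>\<D>. norm (f (Sup k) - f (Inf k))) < e"
  proof (intro exI[of _ "e / (C + 1)"] conjI allI impI)
    fix \<D> :: "real set set"
    assume D: "\<D> division_of \<Union>\<D> \<and> \<Union>\<D> \<subseteq> S \<and> (\<Sum>k\<in>\<D>. Sup k - Inf k) < e / (C + 1)"
    have le: "Inf k \<le> Sup k" if "k \<in> \<D>" for k
    proof -
      have "\<D> division_of \<Union>\<D>" using D by blast
      then have "k \<noteq> {}" "\<exists>a b. k = cbox a b"
        using that division_ofD(3,4) by blast+
      then obtain a b where "k = {a..b}" "a \<le> b" by auto
      then show ?thesis by simp
    qed
    have "(\<Sum>k\<in>\<D>. norm (f (Sup k) - f (Inf k))) \<le> (\<Sum>k\<in>\<D>. C * (Sup k - Inf k))"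
    proof (rule sum_mono)
      fix k assume "k \<in> \<D>"
      then show "norm (f (Sup k) - f (Inf k)) \<le> C * (Sup k - Inf k)"
        using lipschitz_on_normD[OF lip, of "Sup k" "Inf k"] le[of k] by simp
    qed
    also have "\<dots> = C * (\<Sum>k\<in>\<D>. Sup k - Inf k)" by (simp add: sum_distrib_left)
    also have "\<dots> \<le> C * (e / (C + 1))"
      using D C by (intro mult_left_mono) auto
    also have "\<dots> < e" using C \<open>0 < e\<close> by (simp add: field_simps)
    finally show "(\<Sum>k\<in>\<D>. norm (f (Sup k) - f (Inf k))) < e" .
  qed (use \<open>0 < e\<close> C in auto)
qed

lemma lipschitz_imp_ACL_disc:
  assumes lip: "C-lipschitz_on UNIV F"
  shows "ACL_disc F"
proof -
  have C: "0 \<le> C" using lip by (rule lipschitz_on_nonneg)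
  have "C-lipschitz_on UNIV (\<lambda>x. F (Complex x y))" "C-lipschitz_on UNIV (\<lambda>y. F (Complex x y))" for x y
  proof (rule_tac [!] lipschitz_onI[OF _ C])
    fix a b
    have "norm (Complex a y - Complex b y) = \<bar>a - b\<bar>" "norm (Complex x a - Complex x b) = \<bar>a - b\<bar>"
      by (simp_all add: cmod_def)
    then show "dist (F (Complex a y)) (F (Complex b y)) \<le> C * dist a b"
      "dist (F (Complex x a)) (F (Complex x b)) \<le> C * dist a b"
      using lipschitz_onD[OF lip, of "Complex a y" "Complex b y"]
        lipschitz_onD[OF lip, of "Complex x a" "Complex x b"]
      by (simp_all add: dist_norm)
  qed
  then show ?thesis
    unfolding ACL_disc_def by (auto intro: lipschitz_imp_abs_continuous_on)
qed

section \<open>Local degree\<close>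

text \<open>Any circle can be moved to any other through nondegenerate circles, and injectivity keeps the image
  of each of them away from the image of its centre. Hence the local degree of an injective
  continuous map of the plane does not depend on the circle.\<close>

lemma winding_number_injective_circles:
  fixes F :: "complex \<Rightarrow> complex"
  assumes cont: "continuous_on UNIV F" and inj: "inj F" and "0 < r" "0 < s"
  shows "winding_number (F \<circ> circlepath z r) (F z) = winding_number (F \<circ> circlepath w s) (F w)"
proof -
  \<comment> \<open>centre and radius of the intermediate circle at time \<open>t\<close>\<close>
  define c where "c = (\<lambda>t::real. of_real (1 - t) * z + of_real t * w)"
  define \<rho> where "\<rho> = (\<lambda>t::real. (1 - t) * r + t * s)"
  define G where "G = (\<lambda>p. F (c (fst p) + of_real (\<rho> (fst p)) * exp (2 * of_real pi * \<i> * of_real (snd p))) - F (c (fst p)))"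
  have \<rho>: "0 < \<rho> t" if "t \<in> {0..1}" for t
    using that \<open>0 < r\<close> \<open>0 < s\<close> unfolding \<rho>_def
    by (cases "t = 1") (auto intro!: add_pos_nonneg)
  have "homotopic_loops (- {0}) (\<lambda>x. (F \<circ> circlepath z r) x - F z) (\<lambda>x. (F \<circ> circlepath w s) x - F w)"
    unfolding homotopic_loops
  proof (intro exI[of _ G] conjI ballI)
    show "continuous_on ({0..1} \<times> {0..1}) G"
      unfolding G_def c_def \<rho>_def
      by (intro continuous_intros continuous_on_compose2[OF cont]) auto
    show "G \<in> {0..1} \<times> {0..1} \<rightarrow> - {0}"
    proof
      fix p :: "real \<times> real" assume "p \<in> {0..1} \<times> {0..1}"
      then have "\<rho> (fst p) > 0" by (intro \<rho>) auto
      then have "c (fst p) + of_real (\<rho> (fst p)) * exp (2 * of_real pi * \<i> * of_real (snd p)) \<noteq> c (fst p)"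
        by simp
      then show "G p \<in> - {0}"
        unfolding G_def by (simp only: Compl_iff singleton_iff right_minus_eq inj_eq[OF inj] not_False_eq_True)
    qed
    fix t :: real
    show "pathfinish (G \<circ> Pair t) = pathstart (G \<circ> Pair t)"
      by (simp add: pathfinish_def pathstart_def G_def)
  qed (auto simp: G_def c_def \<rho>_def circlepath)
  then have "winding_number (\<lambda>x. (F \<circ> circlepath z r) x - F z) 0 = winding_number (\<lambda>x. (F \<circ> circlepath w s) x - F w) 0"
    by (rule winding_number_homotopic_loops)
  then show ?thesis
    using winding_number_offset[of "F \<circ> circlepath z r" "F z"] winding_number_offset[of "F \<circ> circlepath w s" "F w"]
    by (simp only:)
qed

text \<open>Comparison with the unit circle around \<open>0\<close>, on which the extension is \<open>h\<close> itself.\<close>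

lemma winding_number_radial_extension:
  assumes h: "h \<in> BiLip_circle" and "0 < r"
  shows "winding_number (radial_extension h \<circ> circlepath z r) (radial_extension h z)
      = winding_number (h \<circ> circlepath 0 1) 0"
proof -
  note hS = BiLip_circle_maps_circle[OF h]
  obtain M where "M-lipschitz_on unit_circle h" using BiLip_circle_chord_lipschitz[OF h] .
  then have "continuous_on UNIV (radial_extension h)"
    using radial_extension_lipschitz hS(2) lipschitz_on_continuous_on by blast
  moreover have "inj (radial_extension h)"
    using hS by (intro inj_on_inverseI[of _ "radial_extension (inv_into unit_circle h)"])
      (auto intro!: radial_extension_inverse)
  ultimately have "winding_number (radial_extension h \<circ> circlepath z r) (radial_extension h z)
      = winding_number (radial_extension h \<circ> circlepath 0 1) (radial_extension h 0)"
    using \<open>0 < r\<close> by (intro winding_number_injective_circles) auto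
  also have "radial_extension h \<circ> circlepath 0 1 = h \<circ> circlepath 0 1"
  proof
    fix x
    have "circlepath 0 1 x \<in> unit_circle" by (simp add: circlepath)
    then show "(radial_extension h \<circ> circlepath 0 1) x = (h \<circ> circlepath 0 1) x"
      using radial_extension_polar[of "circlepath 0 1 x" 1 h] by simp
  qed
  finally show ?thesis by (simp only: radial_extension_0)
qed

section \<open>Null sets in logarithmic coordinates\<close>

lemma AE_lebesgue_iff_negligible: "(AE x in lebesgue. P x) \<longleftrightarrow> negligible {x. \<not> P x}"
proof
  assume "AE x in lebesgue. P x"
  then obtain N where "N \<in> null_sets lebesgue" "{x. \<not> P x} \<subseteq> N"
    by (auto simp: eventually_ae_filter)
  then show "negligible {x. \<not> P x}"
    using negligible_iff_null_sets negligible_subset by blast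
next
  assume "negligible {x. \<not> P x}"
  then show "AE x in lebesgue. P x"
    by (intro AE_I'[of "{x. \<not> P x}"]) (auto simp: negligible_iff_null_sets)
qed

lemma negligible_subset_null_lborel:
  assumes "negligible N"
  obtains N' where "N' \<in> null_sets lborel" "N \<subseteq> N'"
  using assms null_sets_completion_subset
  unfolding negligible_iff_null_sets by (auto simp: null_sets_completion_iff2)

lemma negligible_UNIV_Times:
  fixes N :: "real set"
  assumes "negligible N"
  shows "negligible ((UNIV :: real set) \<times> N)"
proof -
  obtain N' where N': "N' \<in> null_sets lborel" "N \<subseteq> N'"
    using negligible_subset_null_lborel[OF assms] .
  have "emeasure (lborel \<Otimes>\<^sub>M lborel) ((UNIV :: real set) \<times> N') = emeasure lborel (UNIV :: real set) * emeasure lborel N'"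
    using N'(1) by (intro lborel.emeasure_pair_measure_Times) auto
  also have "\<dots> = 0" using N'(1) by (simp add: null_setsD1)
  finally have "emeasure lborel ((UNIV :: real set) \<times> N') = 0"
    by (simp add: lborel_prod)
  moreover have "(UNIV :: real set) \<times> N' \<in> sets lborel"
    using N'(1) by (auto simp: borel_prod[symmetric] null_sets_def)
  ultimately have "(UNIV :: real set) \<times> N' \<in> null_sets lborel" by (simp add: null_sets_def)
  then have "negligible ((UNIV :: real set) \<times> N')"
    by (simp add: negligible_iff_null_sets null_sets_completionI)
  then show ?thesis by (rule negligible_subset) (use N'(2) in auto)
qed

text \<open>Fubini: a null set in the plane has null vertical slices over almost every point, hence over some
  point of \<open>A\<close>.\<close>

lemma negligible_Times_right:
  fixes A N :: "real set"
  assumes "negligible (A \<times> N)" "\<not> negligible A"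
  shows "negligible N"
proof -
  obtain B where B: "B \<in> null_sets lborel" "A \<times> N \<subseteq> B"
    using negligible_subset_null_lborel[OF assms(1)] .
  have "AE p in lborel \<Otimes>\<^sub>M lborel. p \<notin> B"
    unfolding lborel_prod by (rule AE_not_in[OF B(1)])
  then have "AE x in lborel. AE y in lborel. (x, y) \<notin> B"
    by (rule lborel_pair.AE_pair)
  then have "AE x in lebesgue. AE y in lborel. (x, y) \<notin> B" by (rule AE_completion)
  then have "negligible {x. \<not> (AE y in lborel. (x, y) \<notin> B)}" by (simp add: AE_lebesgue_iff_negligible)
  then have "\<not> A \<subseteq> {x. \<not> (AE y in lborel. (x, y) \<notin> B)}"
    using assms(2) negligible_subset by blast
  then obtain x where x: "x \<in> A" "AE y in lborel. (x, y) \<notin> B" by blast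
  then have "AE y in lebesgue. (x, y) \<notin> B" by (intro AE_completion)
  then have "negligible {y. (x, y) \<in> B}" by (simp add: AE_lebesgue_iff_negligible)
  then show ?thesis by (rule negligible_subset) (use x(1) B(2) in auto)
qed

text \<open>The exponential map is smooth and hence sends the null set \<open>\<real> \<times> N\<close> of bad angles
  to a null set; apart from \<open>0\<close> every point of the disc has an argument in \<open>[0, 2 pi]\<close>.\<close>

lemma AE_disc_from_angles:
  assumes Q: "AE \<theta> in lebesgue. \<theta> \<in> {0..2 * pi} \<longrightarrow> Q \<theta>"
    and QR: "\<And>w. Q (Im w) \<Longrightarrow> R (exp w)"
  shows "AE z in lebesgue. z \<in> unit_disc \<longrightarrow> R z"
proof -
  define N where "N = {\<theta>. \<not> (\<theta> \<in> {0..2 * pi} \<longrightarrow> Q \<theta>)}"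
  define W where "W = (\<lambda>p. Complex (fst p) (snd p)) ` (UNIV \<times> N)"
  have N: "negligible N" using Q unfolding N_def AE_lebesgue_iff_negligible .
  have "linear (\<lambda>p. Complex (fst p) (snd p))"
    by (intro linearI) (simp_all add: complex_eq_iff)
  then have "negligible W"
    unfolding W_def
    by (intro negligible_differentiable_image_negligible negligible_UNIV_Times N)
       (auto intro: linear_imp_differentiable_on)
  then have "negligible (exp ` W)"
    by (intro negligible_differentiable_image_negligible)
       (auto intro!: holomorphic_on_imp_differentiable_on holomorphic_intros)
  then have "negligible (insert 0 (exp ` W))" by simp
  moreover have "{z. \<not> (z \<in> unit_disc \<longrightarrow> R z)} \<subseteq> insert 0 (exp ` W)"
  proof
    fix z assume z: "z \<in> {z. \<not> (z \<in> unit_disc \<longrightarrow> R z)}"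
    show "z \<in> insert 0 (exp ` W)"
    proof (cases "z = 0")
      case False
      define w where "w = Complex (ln (norm z)) (Arg2pi z)"
      have "exp w = of_real (norm z) * exp (\<i> * of_real (Arg2pi z))"
        unfolding exp_eq_polar[of w] using False by (simp add: w_def cis_conv_exp)
      also have "\<dots> = z" by (rule Arg2pi_eq[symmetric])
      finally have zw: "z = exp w" ..
      then have "Arg2pi z \<in> N"
        using z QR[of w] Arg2pi[of z] by (auto simp: N_def w_def)
      then have "w \<in> W" by (force simp: W_def w_def)
      then show ?thesis using zw by blast
    qed simp
  qed
  ultimately show ?thesis
    unfolding AE_lebesgue_iff_negligible using negligible_subset by blast
qed

text \<open>The exponential map has invertible derivative, so the preimage of a null set is null; the disc
  without \<open>0\<close> corresponds to the half-plane \<open>Re w < 0\<close>, where Fubini applies.\<close>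

lemma AE_angles_from_disc:
  assumes R: "AE z in lebesgue. z \<in> unit_disc \<longrightarrow> R z"
    and RQ: "\<And>w. R (exp w) \<Longrightarrow> Q (Im w)"
  shows "AE \<theta> in lebesgue. Q \<theta>"
proof -
  define T where "T = {z. \<not> (z \<in> unit_disc \<longrightarrow> R z)}"
  define N where "N = {\<theta>. \<not> Q \<theta>}"
  have T: "negligible T" using R unfolding T_def AE_lebesgue_iff_negligible .
  have "negligible {w \<in> UNIV. exp w \<in> T}"
  proof (rule negligible_differentiable_vimage[OF T, where f' = "\<lambda>w v. exp w * v"])
    show "inj ((*) (exp w))" for w :: complex by (auto simp: inj_def)
    show "(exp has_derivative (*) (exp w)) (at w within UNIV)" for w :: complex
      using DERIV_exp[of w] by (simp add: has_field_derivative_def)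
  qed
  then have "negligible ((\<lambda>w. (Re w, Im w)) ` {w \<in> UNIV. exp w \<in> T})"
    by (intro negligible_differentiable_image_negligible)
       (auto intro!: bounded_linear_imp_differentiable_on bounded_linear_Pair bounded_linear_Re bounded_linear_Im)
  then have "negligible ({..<0 :: real} \<times> N)"
  proof (rule negligible_subset, clarify)
    fix a b assume ab: "a < (0::real)" "b \<in> N"
    define w where "w = Complex a b"
    have "\<not> R (exp w)" using ab RQ[of w] by (auto simp: w_def N_def)
    moreover have "exp w \<in> unit_disc" using ab by (simp add: w_def)
    ultimately have "w \<in> {w \<in> UNIV. exp w \<in> T}" by (simp add: T_def)
    then show "(a, b) \<in> (\<lambda>w. (Re w, Im w)) ` {w \<in> UNIV. exp w \<in> T}"
      by (rule rev_image_eqI) (simp add: w_def)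
  qed
  moreover have "\<not> negligible {..<(0::real)}"
    using open_not_negligible[of "{..<(0::real)}"] by (metis lessThan_iff empty_iff open_lessThan lt_ex)
  ultimately have "negligible N" by (rule negligible_Times_right)
  then show ?thesis unfolding N_def AE_lebesgue_iff_negligible .
qed

section \<open>Wirtinger derivatives in logarithmic coordinates\<close>

lemma has_derivative_imp_partials:
  assumes "(F has_derivative F') (at z)"
  shows "has_partials_at F z" "partial_x F z = F' 1" "partial_y F z = F' \<i>"
proof -
  have *: "((\<lambda>t::real. F (z + v * of_real t)) has_vector_derivative F' v) (at 0)" for v
  proof -
    have "((\<lambda>t::real. z + v * of_real t) has_derivative (\<lambda>t. v * of_real t)) (at 0)"
      by (auto intro!: derivative_eq_intros)
    from has_derivative_compose[OF this, of F F']
    have "((\<lambda>t::real. F (z + v * of_real t)) has_derivative (\<lambda>t. F' (v * of_real t))) (at 0)"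
      using assms by simp
    moreover have "F' (v * of_real t) = t *\<^sub>R F' v" for t
      using linear_cmul[OF has_derivative_linear[OF assms], of t v]
      by (simp add: scaleR_conv_of_real mult.commute)
    ultimately show ?thesis by (simp add: has_vector_derivative_def)
  qed
  note x = *[of 1, simplified] and y = *[of \<i>]
  show "partial_x F z = F' 1" "partial_y F z = F' \<i>"
    unfolding partial_x_def partial_y_def by (intro vector_derivative_at x y)+
  show "has_partials_at F z"
    unfolding has_partials_at_def
    using x y by (auto simp: has_vector_derivative_def differentiable_def)
qed

text \<open>Near \<open>z = exp w\<close> the function \<open>u \<mapsto> w + Ln (u / z)\<close> is a branch of the logarithm with value
  \<open>w\<close> at \<open>z\<close>, so \<open>E\<close> is the composition of this branch, the map \<open>s + i t \<mapsto> s + i H t\<close> and \<open>exp\<close>.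
  Differentiability of \<open>H\<close> at the single point \<open>Im w\<close> suffices for the chain rule.\<close>

lemma log_chart_has_derivative:
  assumes E: "\<And>w. E (exp w) = exp (Complex (Re w) (H (Im w)))"
    and D: "(H has_real_derivative d) (at (Im w))"
  shows "(E has_derivative (\<lambda>v. E (exp w) * Complex (Re (v / exp w)) (d * Im (v / exp w)))) (at (exp w))"
proof -
  define z where "z = exp w"
  have z0: "z \<noteq> 0" by (simp add: z_def)
  define G where "G = (\<lambda>v. of_real (Re v) + \<i> * of_real (H (Im v)))"
  have G: "Complex (Re v) (H (Im v)) = G v" for v
    by (simp add: G_def Complex_eq)
  have dH: "(H has_derivative (\<lambda>t. d * t)) (at (Im w))"
    using D by (simp add: has_field_derivative_def)
  have "((\<lambda>v. H (Im v)) has_derivative (\<lambda>v. d * Im v)) (at w)"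
    using has_derivative_compose[OF bounded_linear_imp_has_derivative[OF bounded_linear_Im] dH] .
  then have dG: "(G has_derivative (\<lambda>v. of_real (Re v) + \<i> * of_real (d * Im v))) (at w)"
    unfolding G_def by (auto intro!: derivative_eq_intros)
  have "((\<lambda>u. w + Ln (u / z)) has_field_derivative 1 / z) (at z)"
    using z0 by (auto intro!: derivative_eq_intros)
  then have dLn: "((\<lambda>u. w + Ln (u / z)) has_derivative (\<lambda>v. v / z)) (at z)"
    unfolding has_field_derivative_def by (rule has_derivative_eq_rhs) auto
  have w: "w + Ln (z / z) = w" using z0 by simp
  have dGL: "((\<lambda>u. G (w + Ln (u / z))) has_derivative
      (\<lambda>v. of_real (Re (v / z)) + \<i> * of_real (d * Im (v / z)))) (at z)"
    using has_derivative_compose[OF dLn, of G] dG unfolding w .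
  have "((\<lambda>u. exp (G (w + Ln (u / z)))) has_derivative
      (\<lambda>v. exp (G w) * (of_real (Re (v / z)) + \<i> * of_real (d * Im (v / z))))) (at z)"
    using has_derivative_compose[OF dGL, of exp "(*) (exp (G w))"] DERIV_exp[of "G w"]
    unfolding w by (simp add: has_field_derivative_def)
  then have "(E has_derivative
      (\<lambda>v. exp (G w) * (of_real (Re (v / z)) + \<i> * of_real (d * Im (v / z))))) (at z)"
  proof (rule has_derivative_transform_within_open)
    show "open (- {0::complex})" by (rule open_Compl) (rule closed_singleton)
    show "z \<in> - {0}" using z0 by simp
    fix u assume "u \<in> - {0::complex}"
    then have "exp (w + Ln (u / z)) = u" using z0 by (simp add: exp_add flip: z_def)
    then show "exp (G (w + Ln (u / z))) = E u" using E[of "w + Ln (u / z)"] by (simp only: G)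
  qed
  moreover have "E z = exp (G w)" using E[of w] by (simp only: G z_def)
  ultimately show ?thesis
    unfolding z_def[symmetric] Complex_eq by simp
qed

text \<open>In logarithmic coordinates the differential is \<open>diag (1, d)\<close>, with Wirtinger derivatives
  \<open>(1 + d) / 2\<close> and \<open>(1 - d) / 2\<close>. The conformal factors of \<open>Ln\<close> and \<open>exp\<close> have moduli
  \<open>1 / \<bar>z\<bar>\<close> and \<open>\<bar>E z\<bar> = \<bar>z\<bar>\<close>, which cancel.\<close>

lemma log_chart_wirtinger:
  assumes E: "\<And>w. E (exp w) = exp (Complex (Re w) (H (Im w)))"
    and D: "(H has_real_derivative d) (at (Im w))"
  shows "has_partials_at E (exp w)"
    "norm (wirtinger_z E (exp w)) = \<bar>1 + d\<bar> / 2"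
    "norm (wirtinger_zbar E (exp w)) = \<bar>1 - d\<bar> / 2"
proof -
  define z where "z = exp w"
  define u where "u = 1 / z"
  note P = has_derivative_imp_partials[OF log_chart_has_derivative[OF E D], folded z_def]
  show "has_partials_at E (exp w)" using P(1) by (simp add: z_def)
  have nE: "norm (E z) * norm u = 1"
    by (simp add: z_def u_def E norm_divide)
  have px: "partial_x E z = E z * Complex (Re u) (d * Im u)"
    by (simp add: P(2) u_def)
  have py: "partial_y E z = E z * Complex (- Im u) (d * Re u)"
  proof -
    have "\<i> / z = \<i> * u" by (simp add: u_def)
    then show ?thesis unfolding P(3) by simp
  qed
  have "wirtinger_z E z = E z * (Complex (Re u) (d * Im u) - \<i> * Complex (- Im u) (d * Re u)) / 2"
    by (simp add: wirtinger_z_def px py algebra_simps)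
  also have "Complex (Re u) (d * Im u) - \<i> * Complex (- Im u) (d * Re u) = of_real (1 + d) * u"
    by (simp add: complex_eq_iff algebra_simps)
  finally have "norm (wirtinger_z E z) = \<bar>1 + d\<bar> * (norm (E z) * norm u) / 2"
    by (simp only: norm_mult norm_divide norm_of_real norm_numeral mult_ac)
  then show "norm (wirtinger_z E (exp w)) = \<bar>1 + d\<bar> / 2"
    by (simp add: nE z_def[symmetric])
  have "wirtinger_zbar E z = E z * (Complex (Re u) (d * Im u) + \<i> * Complex (- Im u) (d * Re u)) / 2"
    by (simp add: wirtinger_zbar_def px py algebra_simps)
  also have "Complex (Re u) (d * Im u) + \<i> * Complex (- Im u) (d * Re u) = of_real (1 - d) * cnj u"
    by (simp add: complex_eq_iff algebra_simps)
  finally have "norm (wirtinger_zbar E z) = \<bar>1 - d\<bar> * (norm (E z) * norm u) / 2"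
    by (simp only: norm_mult norm_divide norm_of_real norm_numeral complex_mod_cnj mult_ac)
  then show "norm (wirtinger_zbar E (exp w)) = \<bar>1 - d\<bar> / 2"
    by (simp add: nE z_def[symmetric])
qed

text \<open>After clearing denominators the left-hand side is \<open>d \<le> K\<close> if \<open>d \<ge> 1\<close>, and \<open>1 \<le> K d\<close> if
  \<open>d \<le> 1\<close>; the other inequality is then automatic because \<open>K \<ge> 1\<close>.\<close>

lemma dilatation_inequality_iff:
  fixes d K :: real
  assumes "0 < d" "1 \<le> K"
  shows "\<bar>1 - d\<bar> / 2 \<le> (K - 1) / (K + 1) * (\<bar>1 + d\<bar> / 2) \<longleftrightarrow>
    max (ereal \<bar>d\<bar>) (1 / ereal \<bar>d\<bar>) \<le> ereal K" (is "?lhs \<longleftrightarrow> ?rhs")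
proof -
  have "?lhs \<longleftrightarrow> \<bar>1 - d\<bar> * (K + 1) \<le> (K - 1) * (1 + d)"
  proof -
    define q where "q = (K - 1) * (1 + d) / (K + 1)"
    have "(K - 1) / (K + 1) * (\<bar>1 + d\<bar> / 2) = q / 2"
      using assms by (simp add: q_def)
    then have "?lhs \<longleftrightarrow> \<bar>1 - d\<bar> / 2 \<le> q / 2" by (simp only:)
    also have "\<dots> \<longleftrightarrow> \<bar>1 - d\<bar> \<le> q" by simp
    finally show ?thesis using assms by (simp add: q_def pos_le_divide_eq)
  qed
  also have "\<dots> \<longleftrightarrow> d \<le> K \<and> 1 \<le> K * d"
    using assms by (cases "d \<le> 1") (auto simp: abs_if algebra_simps intro: order_trans mult_right_mono)
  also have "\<dots> \<longleftrightarrow> max (ereal \<bar>d\<bar>) (1 / ereal \<bar>d\<bar>) \<le> ereal K"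
    using assms by (simp add: field_simps one_ereal_def)
  finally show ?thesis .
qed

section \<open>The maximal dilatation as an essential supremum\<close>

text \<open>The value is \<open>\<infinity>\<close> where the derivative vanishes, since \<open>1 / 0 = \<infinity>\<close> in the extended reals.\<close>

definition dilatation_density :: "(real \<Rightarrow> real) \<Rightarrow> real \<Rightarrow> ereal" where
  "dilatation_density H \<theta> = max (ereal \<bar>deriv H \<theta>\<bar>) (1 / ereal \<bar>deriv H \<theta>\<bar>)"

lemma dilatation_density_ge_1: "1 \<le> dilatation_density H \<theta>"
proof (cases "1 \<le> \<bar>deriv H \<theta>\<bar>")
  case True
  then show ?thesis by (simp add: dilatation_density_def le_max_iff_disj one_ereal_def)
next
  case False
  then have "1 \<le> 1 / ereal \<bar>deriv H \<theta>\<bar>"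
    by (cases "deriv H \<theta> = 0") (simp_all add: one_ereal_def field_simps)
  then show ?thesis by (simp add: dilatation_density_def le_max_iff_disj)
qed

text \<open>The essential supremum is itself an essential bound, so the set of bounds is the ray
  \<open>[esssup f, \<infinity>)\<close>. As \<open>f \<ge> 1\<close> on a space of positive measure, this ray lies in \<open>[1, \<infinity>)\<close>,
  the range of \<open>K\<close> admitted for quasiconformal maps.\<close>

lemma Inf_essential_bounds_eq_esssup:
  fixes f :: "'a \<Rightarrow> ereal"
  assumes f: "f \<in> borel_measurable M" and space: "emeasure M (space M) \<noteq> 0"
    and ge: "\<And>x. 1 \<le> f x" and le: "AE x in M. f x \<le> ereal L"
  shows "ereal (Inf {K. 1 \<le> K \<and> (AE x in M. f x \<le> ereal K)}) = esssup M f"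
proof -
  have "1 = esssup M (\<lambda>x. 1 :: ereal)" using esssup_const[OF space, of "1 :: ereal"] by simp
  also have "\<dots> \<le> esssup M f" by (rule esssup_mono) (use ge in auto)
  finally have 1: "1 \<le> esssup M f" .
  have "esssup M f \<le> ereal L" using f le by (rule esssup_I)
  with 1 obtain k where k: "esssup M f = ereal k" by (cases "esssup M f") auto
  have "{K. 1 \<le> K \<and> (AE x in M. f x \<le> ereal K)} = {k..}"
  proof (intro subset_antisym subsetI)
    fix K assume "K \<in> {K. 1 \<le> K \<and> (AE x in M. f x \<le> ereal K)}"
    then have "esssup M f \<le> ereal K" using f by (auto intro: esssup_I)
    then show "K \<in> {k..}" by (simp add: k)
  next
    fix K assume "K \<in> {k..}"
    moreover have "1 \<le> k" using 1 by (simp add: k one_ereal_def)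
    moreover have "AE x in M. f x \<le> ereal k" using esssup_AE[of f M] by (simp add: k)
    ultimately show "K \<in> {K. 1 \<le> K \<and> (AE x in M. f x \<le> ereal K)}"
      by (auto elim!: eventually_mono intro: order_trans)
  qed
  then show ?thesis by (simp add: k)
qed

lemma Inf_dilatation_bounds_eq_esssup:
  assumes h: "h \<in> BiLip_circle" and H: "is_lift h H"
  shows "ereal (Inf {K. 1 \<le> K \<and> (AE \<theta> in lebesgue_on {0..2 * pi}. dilatation_density H \<theta> \<le> ereal K)})
      = esssup (lebesgue_on {0..2 * pi}) (dilatation_density H)"
    and "\<exists>K\<ge>1. AE \<theta> in lebesgue_on {0..2 * pi}. dilatation_density H \<theta> \<le> ereal K"
proof -
  obtain L where L: "L \<ge> 1"
    "\<And>x D. (H has_real_derivative D) (at x) \<Longrightarrow> 1 / L \<le> \<bar>D\<bar> \<and> \<bar>D\<bar> \<le> L"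
    using lift_deriv_bounds[OF h H] by blast
  have "AE \<theta> in lebesgue. dilatation_density H \<theta> \<le> ereal L"
    using lift_AE_differentiable(1)[OF h H]
  proof eventually_elim
    case (elim \<theta>)
    have b: "1 / L \<le> \<bar>deriv H \<theta>\<bar>" "\<bar>deriv H \<theta>\<bar> \<le> L" using L(2)[OF elim] by auto
    moreover have "0 < 1 / L" using L(1) by simp
    ultimately have "0 < \<bar>deriv H \<theta>\<bar>" by linarith
    then have "1 / ereal \<bar>deriv H \<theta>\<bar> = ereal (1 / \<bar>deriv H \<theta>\<bar>)" by (simp add: one_ereal_def)
    moreover have "1 / \<bar>deriv H \<theta>\<bar> \<le> L"
      using b(1) \<open>0 < \<bar>deriv H \<theta>\<bar>\<close> L(1) by (simp add: field_simps)
    ultimately show ?case using b(2) by (simp add: dilatation_density_def)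
  qed
  then have bound: "AE \<theta> in lebesgue_on {0..2 * pi}. dilatation_density H \<theta> \<le> ereal L"
    by (auto simp: AE_restrict_space_iff elim: eventually_mono)
  then show "\<exists>K\<ge>1. AE \<theta> in lebesgue_on {0..2 * pi}. dilatation_density H \<theta> \<le> ereal K"
    using L(1) by blast
  have [measurable]: "deriv H \<in> borel_measurable (lebesgue_on {0..2 * pi})"
    using lift_AE_differentiable(2)[OF h H] by (rule measurable_restrict_space1)
  have "dilatation_density H \<in> borel_measurable (lebesgue_on {0..2 * pi})"
    unfolding dilatation_density_def[abs_def] by measurable
  then show "ereal (Inf {K. 1 \<le> K \<and> (AE \<theta> in lebesgue_on {0..2 * pi}. dilatation_density H \<theta> \<le> ereal K)})
      = esssup (lebesgue_on {0..2 * pi}) (dilatation_density H)"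
  proof (rule Inf_essential_bounds_eq_esssup[OF _ _ dilatation_density_ge_1 bound])
    show "emeasure (lebesgue_on {0..2 * pi}) (space (lebesgue_on {0..2 * pi})) \<noteq> 0"
      by (simp add: emeasure_restrict_space)
  qed
qed

text \<open>Among the conditions defining \<open>K\<close>-quasiconformality only \<open>1 \<le> K\<close> and the dilatation inequality
  depend on \<open>K\<close>. At \<open>z = exp w\<close> the latter says that the density at \<open>Im w\<close> is at most \<open>K\<close>, and
  almost every point of the disc corresponds to almost every angle.\<close>

lemma K_quasiconformal_radial_extension_iff:
  assumes h: "h \<in> BiLip_circle" and H: "is_lift h H"
    and w: "winding_number (h \<circ> circlepath 0 1) 0 = 1"
  shows "K_quasiconformal K (radial_extension h) \<longleftrightarrow>
    1 \<le> K \<and> (AE \<theta> in lebesgue_on {0..2 * pi}. dilatation_density H \<theta> \<le> ereal K)"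
proof (cases "1 \<le> K")
  case K: True
  define E where "E = radial_extension h"
  define P where "P = (\<lambda>\<theta>. (H has_real_derivative deriv H \<theta>) (at \<theta>) \<and> 0 < deriv H \<theta>)"
  define R where "R = (\<lambda>z. has_partials_at E z \<and>
    norm (wirtinger_zbar E z) \<le> (K - 1) / (K + 1) * norm (wirtinger_z E z))"
  obtain L where L: "L \<ge> 1"
    "\<And>x D. (H has_real_derivative D) (at x) \<Longrightarrow> 1 / L \<le> \<bar>D\<bar> \<and> \<bar>D\<bar> \<le> L"
    using lift_deriv_bounds[OF h H] by blast
  have P: "AE \<theta> in lebesgue. P \<theta>"
    using lift_AE_differentiable(1)[OF h H]
  proof eventually_elim
    case (elim \<theta>)
    have "mono H" using lift_strict_mono[OF h H w] by (rule strict_mono_mono)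
    then have "0 \<le> deriv H \<theta>" using elim mono_on_imp_deriv_nonneg[of UNIV H "deriv H \<theta>" \<theta>] by simp
    moreover have "0 < 1 / L" "1 / L \<le> \<bar>deriv H \<theta>\<bar>" using L(1) L(2)[OF elim] by auto
    ultimately have "0 < deriv H \<theta>" by linarith
    with elim show ?case by (simp add: P_def)
  qed
  have R_iff: "R (exp w) \<longleftrightarrow> dilatation_density H (Im w) \<le> ereal K" if "P (Im w)" for w
  proof -
    have d: "(H has_real_derivative deriv H (Im w)) (at (Im w))" "0 < deriv H (Im w)"
      using that by (auto simp: P_def)
    note W = log_chart_wirtinger[of E H, OF radial_extension_exp[OF H, folded E_def] d(1)]
    show ?thesis
      unfolding R_def W(2,3) dilatation_density_def
      using W(1) dilatation_inequality_iff[OF d(2) K] by simp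
  qed
  obtain M where M: "M-lipschitz_on unit_circle h" using BiLip_circle_chord_lipschitz[OF h] .
  have "ACL_disc E"
    unfolding E_def using radial_extension_lipschitz[OF _ M] BiLip_circle_maps_circle(2)[OF h]
    by (auto intro: lipschitz_imp_ACL_disc)
  moreover have "disc_orientation_preserving E"
    unfolding disc_orientation_preserving_def E_def by (simp add: winding_number_radial_extension[OF h] w)
  ultimately have "K_quasiconformal K E \<longleftrightarrow> (AE z in lebesgue. z \<in> unit_disc \<longrightarrow> R z)"
    using K self_homeomorphism_radial_extension[OF h]
    unfolding K_quasiconformal_def R_def by (simp add: E_def)
  also have "\<dots> \<longleftrightarrow> (AE \<theta> in lebesgue. \<theta> \<in> {0..2 * pi} \<longrightarrow> dilatation_density H \<theta> \<le> ereal K)"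
  proof
    assume "AE z in lebesgue. z \<in> unit_disc \<longrightarrow> R z"
    then have "AE \<theta> in lebesgue. P \<theta> \<longrightarrow> dilatation_density H \<theta> \<le> ereal K"
      by (rule AE_angles_from_disc) (use R_iff in blast)
    with P show "AE \<theta> in lebesgue. \<theta> \<in> {0..2 * pi} \<longrightarrow> dilatation_density H \<theta> \<le> ereal K"
      by eventually_elim simp
  next
    assume "AE \<theta> in lebesgue. \<theta> \<in> {0..2 * pi} \<longrightarrow> dilatation_density H \<theta> \<le> ereal K"
    with P have "AE \<theta> in lebesgue. \<theta> \<in> {0..2 * pi} \<longrightarrow> P \<theta> \<and> dilatation_density H \<theta> \<le> ereal K"
      by eventually_elim simp
    then show "AE z in lebesgue. z \<in> unit_disc \<longrightarrow> R z"
      by (rule AE_disc_from_angles) (use R_iff in blast)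
  qed
  also have "\<dots> \<longleftrightarrow> (AE \<theta> in lebesgue_on {0..2 * pi}. dilatation_density H \<theta> \<le> ereal K)"
    by (simp add: AE_restrict_space_iff)
  finally show ?thesis using K by (simp add: E_def)
qed (simp add: K_quasiconformal_def)

section \<open>Precomposition with conjugation\<close>

lemma AE_interval_reflect:
  assumes "AE \<theta> in lebesgue_on {0..a}. Q \<theta>"
  shows "AE \<theta> in lebesgue_on {0..a :: real}. Q (a - \<theta>)"
proof -
  have "negligible {\<theta>. \<not> (\<theta> \<in> {0..a} \<longrightarrow> Q \<theta>)}"
    using assms by (simp add: AE_restrict_space_iff AE_lebesgue_iff_negligible)
  then have "negligible ((\<lambda>\<theta>. a - \<theta>) ` {\<theta>. \<not> (\<theta> \<in> {0..a} \<longrightarrow> Q \<theta>)})"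
    by (intro negligible_differentiable_image_negligible) (auto intro!: derivative_intros)
  then have "negligible {\<theta>. \<not> (\<theta> \<in> {0..a} \<longrightarrow> Q (a - \<theta>))}"
  proof (rule negligible_subset)
    show "{\<theta>. \<not> (\<theta> \<in> {0..a} \<longrightarrow> Q (a - \<theta>))} \<subseteq> (\<lambda>\<theta>. a - \<theta>) ` {\<theta>. \<not> (\<theta> \<in> {0..a} \<longrightarrow> Q \<theta>)}"
    proof
      fix \<theta> assume "\<theta> \<in> {\<theta>. \<not> (\<theta> \<in> {0..a} \<longrightarrow> Q (a - \<theta>))}"
      then show "\<theta> \<in> (\<lambda>\<theta>. a - \<theta>) ` {\<theta>. \<not> (\<theta> \<in> {0..a} \<longrightarrow> Q \<theta>)}"
        by (intro image_eqI[of _ _ "a - \<theta>"]) auto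
    qed
  qed
  then show ?thesis by (simp add: AE_restrict_space_iff AE_lebesgue_iff_negligible)
qed

text \<open>The derivatives of the two lifts at reflected points agree up to sign, but only where \<open>H\<close> is
  differentiable: elsewhere \<^const>\<open>deriv\<close> takes an arbitrary value. Hence the first hypothesis.\<close>

lemma AE_dilatation_density_reflect:
  assumes "AE \<theta> in lebesgue. (H has_real_derivative deriv H \<theta>) (at \<theta>)"
    and "AE \<theta> in lebesgue_on {0..2 * pi}. dilatation_density H \<theta> \<le> ereal K"
  shows "AE \<theta> in lebesgue_on {0..2 * pi}. dilatation_density (\<lambda>\<theta>. H (2 * pi - \<theta>)) \<theta> \<le> ereal K"
proof -
  have "AE \<theta> in lebesgue_on {0..2 * pi}. (H has_real_derivative deriv H \<theta>) (at \<theta>)"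
    using assms(1) by (auto simp: AE_restrict_space_iff elim: eventually_mono)
  then have "AE \<theta> in lebesgue_on {0..2 * pi}.
      (H has_real_derivative deriv H \<theta>) (at \<theta>) \<and> dilatation_density H \<theta> \<le> ereal K"
    using assms(2) by eventually_elim simp
  from AE_interval_reflect[OF this] show ?thesis
  proof eventually_elim
    case (elim \<theta>)
    have "((\<lambda>\<theta>. 2 * pi - \<theta>) has_real_derivative -1) (at \<theta>)"
      by (auto intro!: derivative_eq_intros)
    with elim have "((\<lambda>\<theta>. H (2 * pi - \<theta>)) has_real_derivative - deriv H (2 * pi - \<theta>)) (at \<theta>)"
      using DERIV_chain2[of H "deriv H (2 * pi - \<theta>)" "\<lambda>\<theta>. 2 * pi - \<theta>" \<theta> "-1" UNIV]
      by simp
    then have "deriv (\<lambda>\<theta>. H (2 * pi - \<theta>)) \<theta> = - deriv H (2 * pi - \<theta>)" by (rule DERIV_imp_deriv)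
    then show ?case using elim by (simp add: dilatation_density_def)
  qed
qed

text \<open>The lift \<open>\<theta> \<mapsto> H (2 pi - \<theta>)\<close> is preferred to \<open>\<theta> \<mapsto> H (- \<theta>)\<close> because the reflection then preserves
  \<open>[0, 2 pi]\<close>.\<close>

lemma is_lift_comp_cnj:
  assumes "is_lift h H"
  shows "is_lift (h \<circ> cnj) (\<lambda>\<theta>. H (2 * pi - \<theta>))"
proof -
  have "cnj (cis \<theta>) = cis (2 * pi - \<theta>)" for \<theta> by (simp add: complex_eq_iff)
  moreover have "continuous_on UNIV (\<lambda>\<theta>. H (2 * pi - \<theta>))"
  proof -
    have "continuous_on UNIV H" using assms by (simp add: is_lift_def)
    moreover have "continuous_on UNIV (\<lambda>\<theta>. 2 * pi - \<theta>)" by (intro continuous_intros)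
    ultimately show ?thesis by (rule continuous_on_compose2) simp
  qed
  ultimately show ?thesis using assms by (simp add: is_lift_def)
qed

lemma winding_number_comp_cnj:
  assumes h: "h \<in> BiLip_circle"
  shows "winding_number ((h \<circ> cnj) \<circ> circlepath 0 1) 0 = - winding_number (h \<circ> circlepath 0 1) 0"
proof -
  note hS = BiLip_circle_maps_circle[OF h]
  have "(h \<circ> cnj) \<circ> circlepath 0 1 = reversepath (h \<circ> circlepath 0 1)"
  proof
    fix x
    have "cnj (circlepath 0 1 x) = circlepath 0 1 (1 - x)"
      by (simp add: circlepath exp_cnj algebra_simps exp_diff exp_minus inverse_eq_divide)
    then show "((h \<circ> cnj) \<circ> circlepath 0 1) x = reversepath (h \<circ> circlepath 0 1) x"
      by (simp add: reversepath_def)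
  qed
  moreover have "path (h \<circ> circlepath 0 1)" "0 \<notin> path_image (h \<circ> circlepath 0 1)"
    using hS(1,2) by (auto intro!: path_continuous_image simp: path_image_compose)
  ultimately show ?thesis using winding_number_reversepath by simp
qed

section \<open>The dilatation of the radial extension\<close>

theorem proposition3p17:
  fixes h :: "complex \<Rightarrow> complex" and H :: "real \<Rightarrow> real"
  assumes "h \<in> BiLip_circle" and "is_lift h H"
  shows "(circle_orientation_preserving h \<longrightarrow> quasiconformal (radial_extension h)) \<and>
         (circle_orientation_reversing h \<longrightarrow> antiquasiconformal (radial_extension h)) \<and>
         ereal (max_dilatation (radial_extension h)) =
           esssup (lebesgue_on {0..2 * pi})
             (\<lambda>\<theta>. max (ereal \<bar>deriv H \<theta>\<bar>) (1 / ereal \<bar>deriv H \<theta>\<bar>))"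
proof -
  note h = assms(1) and H = assms(2)
  let ?E = "radial_extension h"
  let ?bound = "\<lambda>H K. AE \<theta> in lebesgue_on {0..2 * pi}. dilatation_density H \<theta> \<le> ereal K"
  note Inf = Inf_dilatation_bounds_eq_esssup[OF h H]
  have "(\<lambda>\<theta>. max (ereal \<bar>deriv H \<theta>\<bar>) (1 / ereal \<bar>deriv H \<theta>\<bar>)) = dilatation_density H"
    by (simp add: dilatation_density_def fun_eq_iff)
  then have esssup: "esssup (lebesgue_on {0..2 * pi})
      (\<lambda>\<theta>. max (ereal \<bar>deriv H \<theta>\<bar>) (1 / ereal \<bar>deriv H \<theta>\<bar>)) = ereal (Inf {K. 1 \<le> K \<and> ?bound H K})"
    by (simp only: Inf(1))
  consider "winding_number (h \<circ> circlepath 0 1) 0 = 1" | "winding_number (h \<circ> circlepath 0 1) 0 = -1"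
    using winding_number_circle_homeomorphism[OF h] by blast
  then show ?thesis
  proof cases
    case 1
    note iff = K_quasiconformal_radial_extension_iff[OF h H 1]
    have "quasiconformal ?E" unfolding quasiconformal_def iff using Inf(2) by blast
    moreover from this have "max_dilatation ?E = Inf {K. 1 \<le> K \<and> ?bound H K}"
      by (simp add: max_dilatation_def iff)
    ultimately show ?thesis
      using 1 by (simp add: esssup circle_orientation_reversing_def)
  next
    case 2
    define H' where "H' = (\<lambda>\<theta>. H (2 * pi - \<theta>))"
    have h': "h \<circ> cnj \<in> BiLip_circle" by (rule BiLip_circle_cnj[OF h])
    have H': "is_lift (h \<circ> cnj) H'" unfolding H'_def by (rule is_lift_comp_cnj[OF H])
    have w': "winding_number ((h \<circ> cnj) \<circ> circlepath 0 1) 0 = 1"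
      using winding_number_comp_cnj[OF h] 2 by simp
    have H'': "H = (\<lambda>\<theta>. H' (2 * pi - \<theta>))" by (simp add: H'_def)
    have "?bound H' K \<longleftrightarrow> ?bound H K" for K
    proof
      show "?bound H' K" if "?bound H K"
        unfolding H'_def using lift_AE_differentiable(1)[OF h H] that by (rule AE_dilatation_density_reflect)
      show "?bound H K" if "?bound H' K"
        unfolding H'' using lift_AE_differentiable(1)[OF h' H'] that by (rule AE_dilatation_density_reflect)
    qed
    then have iff: "K_quasiconformal K (?E \<circ> cnj) \<longleftrightarrow> 1 \<le> K \<and> ?bound H K" for K
      using K_quasiconformal_radial_extension_iff[OF h' H' w'] by (simp add: radial_extension_comp_cnj)
    have "\<not> disc_orientation_preserving ?E"
    proof
      assume "disc_orientation_preserving ?E"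
      then have "winding_number (?E \<circ> circlepath 0 (1/2)) (?E 0) = 1"
        unfolding disc_orientation_preserving_def
        by (elim allE[of _ 0] allE[of _ "1/2"] impE) auto
      then show False using winding_number_radial_extension[OF h, of "1/2" 0] 2 by simp
    qed
    then have "\<not> quasiconformal ?E"
      by (auto simp: quasiconformal_def K_quasiconformal_def)
    then have "max_dilatation ?E = Inf {K. 1 \<le> K \<and> ?bound H K}"
      by (simp add: max_dilatation_def iff)
    moreover have "antiquasiconformal ?E"
      unfolding antiquasiconformal_def quasiconformal_def iff
      using Inf(2) self_homeomorphism_radial_extension[OF h] by blast
    ultimately show ?thesis
      using 2 by (simp add: esssup circle_orientation_preserving_def)
  qed
qed

end
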